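(* Let $1\le p\le q\le+\infty$, $T>0$, $x_0,x_T\in\mathbb{R}^d$, let $U$ be a closed convex subset of $L_q^m(0,T)$, and consider the fixed-endpoint problem $$\min\ \mathcal{I}(x,u)=\int_0^T\theta(x(t),u(t),t)\,dt\quad\text{subject to}\quad \dot x(t)=A(t)x(t)+B(t)u(t),\ t\in[0,T],\ u\in U,\ x(0)=x_0,\ x(T)=x_T \qquad(\ast)$$ over $(x,u)\in X=W^d_{1,p}(0,T)\times L^m_q(0,T)$. Let $A$ be the set of all $(x,u)\in X$ with $x(0)=x_0$, $u\in U$ and $\dot x(t)=A(t)x(t)+B(t)u(t)$ for a.e. $t\in[0,T]$; put $\varphi(x,u)=|x(T)-x_T|$ and $\Phi_\lambda(x,u)=\mathcal{I}(x,u)+\lambda|x(T)-x_T|$. Let $\mathcal{I}^*$ be the optimal value of $(\ast)$. Suppose that: 1. $A(\cdot)\in L_\infty^{d\times d}(0,T)$ and $B(\cdot)\in L_\infty^{d\times m}(0,T)$; 2. $\theta\colon\mathbb{R}^d\times\mathbb{R}^m\times[0,T]\to\mathbb{R}$, $\theta=\theta(x,u,t)$, is continuous, differentiable in $x$ and $u$, and $\nabla_x\theta$ and $\nabla_u\theta$ are continuous; 3. either $q=+\infty$, or $\theta$ and $\nabla_x\theta$ satisfy the growth condition of order $(q,1)$ while $\nabla_u\theta$ satisfies the growth condition of order $(q-1,q')$; 4. there exists a globally optimal solution of $(\ast)$, and $x_T$ belongs to the relative interior of the reachable set $\mathcal{R}(x_0,T)$ (in the case $U=L^m_q(0,T)$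 this relative interior assumption holds automatically); 5. there exist $\lambda_0>0$, $c>\mathcal{I}^*$ and $\delta>0$ such that the set $S_{\lambda_0}(c)\cap\Omega_\delta$ is bounded in $X$, and $\Phi_{\lambda_0}$ is bounded below on the set $A$. Then there exists $\lambda^*\ge0$ such that for any $\lambda\ge\lambda^*$ the penalty function $\Phi_\lambda$ for problem $(\ast)$ is completely exact on $S_\lambda(c)$.
   Context: Spaces: $L^m_q(0,T)$ is the product of $m$ copies of $L^q(0,T)$ with norm $\|u\|_q=(\int_0^T|u(t)|^q\,dt)^{1/q}$ (ess sup of the Euclidean norm $|u(t)|$ if $q=+\infty$). $W^d_{1,p}(0,T)$ is the space of absolutely continuous $x\colon[0,T]\to\mathbb{R}^d$ with $\dot x\in L^d_p(0,T)$, norm $\|x\|_{1,p}=\|x\|_p+\|\dot x\|_p$. $X$ carries the sum norm. $r'$ is the conjugate exponent of $r$. Growth condition: $g\colon\mathbb{R}^d\times\mathbb{R}^m\times[0,T]\to\mathbb{R}^k$ satisfies the growth condition of order $(l,s)$, $0\le l<+\infty$, $1\le s\le+\infty$, if for any $R>0$ there exist $C_R>0$ and an a.e. nonnegative $\omega_R\in L^s(0,T)$ with $|g(x,u,t)|\le C_R|u|^l+\omega_R(t)$ for a.e. $t\in[0,T]$ and all $(x,u)$ with $|x|\le R$. Reachable set: $\mathcal{R}(x_0,T)=\{x(T)\mid (x,u)\in A\}$, a convex set; its relative interior is the interior relative to its affine hull. Penalty notation: the symbol $A$ (without argument) is a subset of $X$, $A(\cdot)$ is a matrix function. $\Omega=\{(x,u)\in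 A\mid\varphi(x,u)=0\}$ is the feasible set of $(\ast)$, $\Omega_\delta=\{(x,u)\in A\mid\varphi(x,u)<\delta\}$, $S_\lambda(c)=\{(x,u)\in A\mid\Phi_\lambda(x,u)<c\}$. For $K\subseteq X$, $f\colon X\to\mathbb{R}$ and $z\in K$, $f^{\downarrow}_K(z)=\liminf_{y\to z,\,y\in K}\frac{f(y)-f(z)}{\|y-z\|_X}$ ($+\infty$ if $z$ is isolated in $K$); $z$ is an inf-stationary point of $f$ on $K$ if $f^{\downarrow}_K(z)\ge0$. $\Phi_\lambda$ is completely exact on $S_\lambda(c)$ if: (1) the optimal values of $\min_\Omega\mathcal{I}$ and $\min_A\Phi_\lambda$ coincide; (2) their globally optimal solutions coincide; (3) $z\in S_\lambda(c)$ is a locally optimal solution of $\min_A\Phi_\lambda$ iff $z\in\Omega$ and $z$ is a locally optimal solution of $\min_\Omega\mathcal{I}$; (4) $z\in S_\lambda(c)$ is an inf-stationary point of $\Phi_\lambda$ on $A$ iff $z\in\Omega$ and $z$ is an inf-stationary point of $\mathcal{I}$ on $\Omega$. Local optimality is with respect to the norm of $X$. *)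

theory Defs
  imports "HOL-Analysis.Analysis" "HOL-Probability.Essential_Supremum"
begin

section \<open>Lebesgue and Sobolev spaces on an interval\<close>

text \<open>
  Elements of the function spaces are represented by functions on the real line, of which only the
  restriction to \<open>[0,T]\<close> matters; the norms below are therefore seminorms, which vanish precisely on
  the representatives of zero. Exponents are extended reals in \<open>[1,\<infinity>]\<close>.
\<close>

definition Lp :: "ereal \<Rightarrow> real \<Rightarrow> (real \<Rightarrow> 'a::real_normed_vector) set" where
  "Lp q T = {u \<in> borel_measurable (lebesgue_on {0..T}).
     if q = \<infinity> then esssup (lebesgue_on {0..T}) (\<lambda>t. ereal (norm (u t))) < \<infinity>
     else integrable (lebesgue_on {0..T}) (\<lambda>t. norm (u t) powr real_of_ereal q)}"

definition Lp_norm :: "ereal \<Rightarrow> real \<Rightarrow> (real \<Rightarrow> 'a::real_normed_vector) \<Rightarrow> real" where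
  "Lp_norm q T u =
     (if q = \<infinity> then real_of_ereal (esssup (lebesgue_on {0..T}) (\<lambda>t. ereal (norm (u t))))
      else (LINT t|lebesgue_on {0..T}. norm (u t) powr real_of_ereal q) powr (1 / real_of_ereal q))"

text \<open>With \<open>1 / 0 = \<infinity>\<close> and \<open>1 / \<infinity> = 0\<close> in the extended reals, this also covers \<open>r = 1\<close> and \<open>r = \<infinity>\<close>.\<close>

definition conj_exponent :: "ereal \<Rightarrow> ereal" where
  "conj_exponent r = 1 / (1 - 1 / r)"

definition abs_continuous :: "real \<Rightarrow> (real \<Rightarrow> 'a::real_normed_vector) \<Rightarrow> bool" where
  "abs_continuous T x \<longleftrightarrow>
     (\<forall>\<epsilon>>0. \<exists>\<delta>>0. \<forall>(n::nat) a b.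
        (\<forall>i<n. 0 \<le> a i \<and> a i \<le> b i \<and> b i \<le> T) \<and>
        disjoint_family_on (\<lambda>i. {a i<..<b i}) {..<n} \<and>
        (\<Sum>i<n. b i - a i) < \<delta> \<longrightarrow>
        (\<Sum>i<n. norm (x (b i) - x (a i))) < \<epsilon>)"

text \<open>
  An absolutely continuous function with values in a Euclidean space is differentiable almost
  everywhere, so the unspecified values of the derivative at the remaining points are irrelevant.
\<close>

definition deriv_on :: "real \<Rightarrow> (real \<Rightarrow> 'a::real_normed_vector) \<Rightarrow> real \<Rightarrow> 'a" where
  "deriv_on T x t = vector_derivative x (at t within {0..T})"

definition W1p :: "ereal \<Rightarrow> real \<Rightarrow> (real \<Rightarrow> 'a::euclidean_space) set" where
  "W1p p T = {x. abs_continuous T x \<and> deriv_on T x \<in> Lp p T}"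

definition W1p_norm :: "ereal \<Rightarrow> real \<Rightarrow> (real \<Rightarrow> 'a::euclidean_space) \<Rightarrow> real" where
  "W1p_norm p T x = Lp_norm p T x + Lp_norm p T (deriv_on T x)"

type_synonym ('d, 'm) process = "(real \<Rightarrow> real ^ 'd) \<times> (real \<Rightarrow> real ^ 'm)"

definition X_space :: "ereal \<Rightarrow> ereal \<Rightarrow> real \<Rightarrow> ('d::finite, 'm::finite) process set" where
  "X_space p q T = W1p p T \<times> Lp q T"

definition X_norm :: "ereal \<Rightarrow> ereal \<Rightarrow> real \<Rightarrow> ('d::finite, 'm::finite) process \<Rightarrow> real" where
  "X_norm p q T z = W1p_norm p T (fst z) + Lp_norm q T (snd z)"

definition X_dist ::
  "ereal \<Rightarrow> ereal \<Rightarrow> real \<Rightarrow> ('d::finite, 'm::finite) process \<Rightarrow> ('d, 'm) process \<Rightarrow> real" where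
  "X_dist p q T y z = X_norm p q T (\<lambda>t. fst y t - fst z t, \<lambda>t. snd y t - snd z t)"

text \<open>
  Closedness includes invariance under changes on null sets: a representative \<open>u\<close> at seminorm
  distance zero from some \<open>v \<in> U\<close> belongs to \<open>U\<close>.
\<close>

definition closed_in_Lp :: "ereal \<Rightarrow> real \<Rightarrow> (real \<Rightarrow> 'a::real_normed_vector) set \<Rightarrow> bool" where
  "closed_in_Lp q T U \<longleftrightarrow> U \<subseteq> Lp q T \<and>
     (\<forall>u\<in>Lp q T. (\<forall>\<epsilon>>0. \<exists>v\<in>U. Lp_norm q T (\<lambda>t. u t - v t) < \<epsilon>) \<longrightarrow> u \<in> U)"

definition convex_funs :: "(real \<Rightarrow> 'a::real_vector) set \<Rightarrow> bool" where
  "convex_funs U \<longleftrightarrow>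
     (\<forall>u\<in>U. \<forall>v\<in>U. \<forall>\<alpha>\<in>{0..1}. (\<lambda>t. (1 - \<alpha>) *\<^sub>R u t + \<alpha> *\<^sub>R v t) \<in> U)"


section \<open>Growth condition\<close>

text \<open>The case distinction implements \<open>0\<^sup>0 = 1\<close>, whereas \<open>0 powr 0 = 0\<close>.\<close>

definition growth_condition ::
  "real \<Rightarrow> real \<Rightarrow> ereal \<Rightarrow>
     ('a::real_normed_vector \<Rightarrow> 'b::real_normed_vector \<Rightarrow> real \<Rightarrow> 'c::real_normed_vector) \<Rightarrow> bool" where
  "growth_condition T l s g \<longleftrightarrow>
     (\<forall>R>0. \<exists>C>0. \<exists>\<omega>::real \<Rightarrow> real.
        \<omega> \<in> Lp s T \<and> (AE t in lebesgue_on {0..T}. 0 \<le> \<omega> t) \<and>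
        (AE t in lebesgue_on {0..T}. \<forall>x u. norm x \<le> R \<longrightarrow>
           norm (g x u t) \<le> C * (if l = 0 then 1 else norm u powr l) + \<omega> t))"


section \<open>Optimality, inf-stationarity and complete exactness\<close>

text \<open>
  Throughout, \<open>D\<close> is the distance function of the underlying space; it may vanish on distinct
  representatives of the same point.
\<close>

definition globally_optimal :: "('z \<Rightarrow> real) \<Rightarrow> 'z set \<Rightarrow> 'z \<Rightarrow> bool" where
  "globally_optimal f K z \<longleftrightarrow> z \<in> K \<and> (\<forall>y\<in>K. f z \<le> f y)"

definition locally_optimal :: "('z \<Rightarrow> 'z \<Rightarrow> real) \<Rightarrow> ('z \<Rightarrow> real) \<Rightarrow> 'z set \<Rightarrow> 'z \<Rightarrow> bool" where
  "locally_optimal D f K z \<longleftrightarrow> z \<in> K \<and> (\<exists>r>0. \<forall>y\<in>K. D y z < r \<longrightarrow> f z \<le> f y)"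

definition optimal_value :: "('z \<Rightarrow> real) \<Rightarrow> 'z set \<Rightarrow> ereal" where
  "optimal_value f K = (INF z\<in>K. ereal (f z))"

text \<open>
  The filter describes \<open>y \<rightarrow> z\<close>, \<open>y \<noteq> z\<close>, \<open>y \<in> K\<close>. It is trivial if \<open>z\<close> is isolated in \<open>K\<close>, in which
  case the lower limit is \<open>\<infinity>\<close>.
\<close>

definition rate_of_descent :: "('z \<Rightarrow> 'z \<Rightarrow> real) \<Rightarrow> ('z \<Rightarrow> real) \<Rightarrow> 'z set \<Rightarrow> 'z \<Rightarrow> ereal" where
  "rate_of_descent D f K z =
     Liminf (inf (filtercomap (\<lambda>y. D y z) (at_right 0)) (principal K))
       (\<lambda>y. ereal ((f y - f z) / D y z))"

definition inf_stationary :: "('z \<Rightarrow> 'z \<Rightarrow> real) \<Rightarrow> ('z \<Rightarrow> real) \<Rightarrow> 'z set \<Rightarrow> 'z \<Rightarrow> bool" where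
  "inf_stationary D f K z \<longleftrightarrow> z \<in> K \<and> 0 \<le> rate_of_descent D f K z"

definition penalty :: "('z \<Rightarrow> real) \<Rightarrow> ('z \<Rightarrow> real) \<Rightarrow> real \<Rightarrow> 'z \<Rightarrow> real" where
  "penalty f \<phi> \<mu> z = f z + \<mu> * \<phi> z"

definition feasible_set :: "'z set \<Rightarrow> ('z \<Rightarrow> real) \<Rightarrow> 'z set" where
  "feasible_set K \<phi> = {z \<in> K. \<phi> z = 0}"

definition sublevel :: "'z set \<Rightarrow> ('z \<Rightarrow> real) \<Rightarrow> real \<Rightarrow> 'z set" where
  "sublevel K f c = {z \<in> K. f z < c}"

definition completely_exact ::
  "('z \<Rightarrow> 'z \<Rightarrow> real) \<Rightarrow> 'z set \<Rightarrow> ('z \<Rightarrow> real) \<Rightarrow> ('z \<Rightarrow> real) \<Rightarrow> real \<Rightarrow> 'z set \<Rightarrow> bool" where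
  "completely_exact D K f \<phi> \<mu> S \<longleftrightarrow>
     optimal_value f (feasible_set K \<phi>) = optimal_value (penalty f \<phi> \<mu>) K \<and>
     {z. globally_optimal f (feasible_set K \<phi>) z} = {z. globally_optimal (penalty f \<phi> \<mu>) K z} \<and>
     (\<forall>z\<in>S. locally_optimal D (penalty f \<phi> \<mu>) K z \<longleftrightarrow>
        z \<in> feasible_set K \<phi> \<and> locally_optimal D f (feasible_set K \<phi>) z) \<and>
     (\<forall>z\<in>S. inf_stationary D (penalty f \<phi> \<mu>) K z \<longleftrightarrow>
        z \<in> feasible_set K \<phi> \<and> inf_stationary D f (feasible_set K \<phi>) z)"


section \<open>The linear control problem\<close>

definition admissible ::
  "ereal \<Rightarrow> ereal \<Rightarrow> real \<Rightarrow> (real \<Rightarrow> real ^ 'd ^ 'd) \<Rightarrow> (real \<Rightarrow> real ^ 'm ^ 'd) \<Rightarrow>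
     (real \<Rightarrow> real ^ 'm) set \<Rightarrow> real ^ 'd \<Rightarrow> ('d::finite, 'm::finite) process set" where
  "admissible p q T A B U x0 = {(x, u) \<in> X_space p q T. x 0 = x0 \<and> u \<in> U \<and>
     (AE t in lebesgue_on {0..T}.
        (x has_vector_derivative (A t *v x t + B t *v u t)) (at t within {0..T}))}"

definition reachable_set :: "real \<Rightarrow> ('d::finite, 'm::finite) process set \<Rightarrow> (real ^ 'd) set" where
  "reachable_set T K = {x T |x u. (x, u) \<in> K}"

definition cost ::
  "real \<Rightarrow> (real ^ 'd \<Rightarrow> real ^ 'm \<Rightarrow> real \<Rightarrow> real) \<Rightarrow> ('d::finite, 'm::finite) process \<Rightarrow> real" where
  "cost T \<theta> z = (LINT t|lebesgue_on {0..T}. \<theta> (fst z t) (snd z t) t)"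

definition endpoint_error :: "real \<Rightarrow> real ^ 'd \<Rightarrow> ('d::finite, 'm::finite) process \<Rightarrow> real" where
  "endpoint_error T xT z = norm (fst z T - xT)"

end

(* The idea of the proof: the reachable set is the increasing union of the convex sets E n of endpoints of
   trajectories of norm at most n. Since xT is a relative interior point, a ball around xT in the affine
   hull lies in a single E n. A trajectory y with y(T) = xT + h, h /= 0, can thus be moved along the segment
   towards a trajectory of norm at most n ending at xT - r h / |h|. Per unit of the segment parameter the
   endpoint error decreases by more than r, whereas the cost, by the mean value theorem and the growth
   conditions, increases by at most a constant L that is uniform on bounded sets. For mu > L / r no
   infeasible point is stationary, and points near a feasible z can be corrected to feasible ones at a
   price bounded by mu times their endpoint error. *)

theory Submission
  imports Defs
begin

section \<open>Exactness from uniform descent\<close>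

text \<open>The constant \<open>L\<close> is uniform only on bounded sets, so descent may be invoked
  only where the norm is controlled. Raising the penalty parameter by
  \<open>(\<bar>c - m\<bar> + 1) / \<delta>\<close>, with \<open>m\<close> a lower bound of the
  penalty at \<open>\<mu>\<^sub>0\<close>, pushes every point of the sublevel set below
  \<open>c\<close> into the region where the endpoint error is less than \<open>\<delta>\<close>,
  hence into the set assumed bounded. The target endpoint lies opposite to y(T) on the line through
  xT. The error therefore stays on one line and falls exactly linearly along the segment, until the
  segment parameter \<open>\<phi> / (\<phi> + r)\<close> gives a feasible process. The displacement
  this costs is at most a multiple of the endpoint error, which is itself Lipschitz; so a point near
  a feasible z is corrected without leaving a proportional neighbourhood of z. This proportionality
  is what transfers inf-stationarity, a statement about rates, and not only local optimality.
  Processes are representatives, so distinct points may have distance zero. Quotients say nothing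
  about them; there the cost has to be shown equal directly.\<close>

text \<open>A lower limit is nonnegative iff the quotients eventually exceed every negative number,
  and multiplying by the positive distance removes the division. In this form the inequality can be
  compared between the feasible set and the larger set, at different points and tolerances.\<close>

lemma inf_stationary_iff:
  "inf_stationary D f K z \<longleftrightarrow> z \<in> K \<and>
    (\<forall>\<epsilon>>0. \<exists>r>0. \<forall>y\<in>K. 0 < D y z \<and> D y z < r \<longrightarrow> - \<epsilon> * D y z \<le> f y - f z)"
proof (cases "z \<in> K")
  case True
  let ?F = "inf (filtercomap (\<lambda>y. D y z) (at_right 0)) (principal K)"
  let ?g = "\<lambda>y. (f y - f z) / D y z"
  have ev: "eventually P ?F \<longleftrightarrow> (\<exists>r>0. \<forall>y\<in>K. 0 < D y z \<and> D y z < r \<longrightarrow> P y)" for P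
  proof
    assume "eventually P ?F"
    then obtain Q where Q: "eventually Q (at_right 0)" "\<And>y. Q (D y z) \<Longrightarrow> y \<in> K \<Longrightarrow> P y"
      unfolding eventually_inf_principal eventually_filtercomap by blast
    then obtain b where "0 < b" "\<And>d. 0 < d \<Longrightarrow> d < b \<Longrightarrow> Q d"
      unfolding eventually_at_right_field by blast
    then show "\<exists>r>0. \<forall>y\<in>K. 0 < D y z \<and> D y z < r \<longrightarrow> P y" using Q(2) by blast
  next
    assume "\<exists>r>0. \<forall>y\<in>K. 0 < D y z \<and> D y z < r \<longrightarrow> P y"
    then obtain r where r: "0 < r" "\<forall>y\<in>K. 0 < D y z \<and> D y z < r \<longrightarrow> P y" by blast
    have "eventually (\<lambda>d. 0 < d \<and> d < r) (at_right 0)"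
      using r(1) by (auto simp: eventually_at_right_field)
    then show "eventually P ?F"
      unfolding eventually_inf_principal eventually_filtercomap using r(2) by blast
  qed
  have "0 \<le> Liminf ?F (\<lambda>y. ereal (?g y)) \<longleftrightarrow> (\<forall>\<epsilon>>0. eventually (\<lambda>y. - \<epsilon> \<le> ?g y) ?F)"
  proof
    assume *: "0 \<le> Liminf ?F (\<lambda>y. ereal (?g y))"
    show "\<forall>\<epsilon>>0. eventually (\<lambda>y. - \<epsilon> \<le> ?g y) ?F"
    proof (intro allI impI)
      fix \<epsilon> :: real assume "0 < \<epsilon>"
      then have "ereal (- \<epsilon>) < 0" by simp
      with * have "eventually (\<lambda>y. ereal (- \<epsilon>) < ereal (?g y)) ?F"
        unfolding le_Liminf_iff by blast
      then show "eventually (\<lambda>y. - \<epsilon> \<le> ?g y) ?F"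
        by (rule eventually_mono) simp
    qed
  next
    assume *: "\<forall>\<epsilon>>0. eventually (\<lambda>y. - \<epsilon> \<le> ?g y) ?F"
    show "0 \<le> Liminf ?F (\<lambda>y. ereal (?g y))"
      unfolding le_Liminf_iff
    proof (intro allI impI)
      fix b :: ereal assume "b < 0"
      then obtain e where e: "b < ereal e" "ereal e < 0"
        using ereal_dense2 by blast
      then have "eventually (\<lambda>y. - (- e) \<le> ?g y) ?F"
        using * by (metis ereal_less(2) neg_0_less_iff_less less_ereal.simps(1) zero_ereal_def)
      then show "eventually (\<lambda>y. b < ereal (?g y)) ?F"
        by (rule eventually_mono) (use e(1) in \<open>simp add: less_le_trans\<close>)
    qed
  qed
  moreover have "(- \<epsilon> \<le> ?g y) = (- \<epsilon> * D y z \<le> f y - f z)" if "0 < D y z" for \<epsilon> y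
    using that by (rule pos_le_divide_eq)
  ultimately show ?thesis
    unfolding inf_stationary_def rate_of_descent_def ev using True by (smt (verit))
qed (simp add: inf_stationary_def)

text \<open>
  In \<open>descent\<close>, the violation of the constraint drops along \<open>g\<close> at least at the rate \<open>r\<close>, while \<open>f\<close>
  rises at most at the rate \<open>L\<close>, so \<open>\<mu> > L / r\<close> suffices; the largest admissible \<open>a\<close> gives a feasible point.
\<close>

lemma completely_exact_if_descent:
  fixes D :: "'z \<Rightarrow> 'z \<Rightarrow> real" and N f \<phi> :: "'z \<Rightarrow> real"
  assumes D_refl: "\<And>y. y \<in> K \<Longrightarrow> D y y = 0"
    and D_tri: "\<And>x y z. x \<in> K \<Longrightarrow> y \<in> K \<Longrightarrow> z \<in> K \<Longrightarrow> D x z \<le> D x y + D y z"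
    and N_D: "\<And>y z. y \<in> K \<Longrightarrow> z \<in> K \<Longrightarrow> N y \<le> N z + D y z"
    and \<phi>_D: "\<And>y z. y \<in> K \<Longrightarrow> z \<in> K \<Longrightarrow> \<bar>\<phi> y - \<phi> z\<bar> \<le> C * D y z" and C: "0 < C"
    and f_eq: "\<And>y z. y \<in> K \<Longrightarrow> z \<in> K \<Longrightarrow> D y z = 0 \<Longrightarrow> f y = f z"
    and \<phi>_nonneg: "\<And>y. 0 \<le> \<phi> y"
    and descent: "\<And>M. \<exists>\<kappa>>0. \<exists>L\<ge>0. \<exists>r>0. \<forall>y\<in>K. N y \<le> M \<longrightarrow> 0 < \<phi> y \<longrightarrow> (\<exists>g. \<forall>a. 
         0 < a \<and> a \<le> \<phi> y / (\<phi> y + r) \<longrightarrow>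
         g a \<in> K \<and> f (g a) \<le> f y + a * L \<and> D (g a) y \<le> a * \<kappa> \<and>
         \<phi> (g a) = \<phi> y - a * (\<phi> y + r))"
    and opt: "globally_optimal f (feasible_set K \<phi>) z0"
    and c: "f z0 < c"
    and "0 < \<delta>"
    and bounded: "\<And>z. z \<in> K \<Longrightarrow> penalty f \<phi> \<mu>\<^sub>0 z < c \<Longrightarrow> \<phi> z < \<delta> \<Longrightarrow> N z \<le> M"
    and below: "\<And>z. z \<in> K \<Longrightarrow> m \<le> penalty f \<phi> \<mu>\<^sub>0 z"
  shows "\<exists>\<mu>\<^sub>1\<ge>0. \<forall>\<mu>\<ge>\<mu>\<^sub>1. completely_exact D K f \<phi> \<mu> (sublevel K (penalty f \<phi> \<mu>) c)"
proof -
  \<comment> \<open>The level is \<open>M + 1\<close> because descent is also applied at points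
    within distance 1 of the sublevel set, whose norms may exceed \<open>M\<close>.\<close>
  obtain \<kappa> L r where pos: "0 < \<kappa>" "0 \<le> L" "0 < r" and
    desc: "\<And>y. y \<in> K \<Longrightarrow> N y \<le> M + 1 \<Longrightarrow> 0 < \<phi> y \<Longrightarrow> \<exists>g. \<forall>a. 
         0 < a \<and> a \<le> \<phi> y / (\<phi> y + r) \<longrightarrow>
         g a \<in> K \<and> f (g a) \<le> f y + a * L \<and> D (g a) y \<le> a * \<kappa> \<and>
         \<phi> (g a) = \<phi> y - a * (\<phi> y + r)"
    using descent[of "M + 1"] by metis
  \<comment> \<open>The middle term rules out \<open>\<phi> z \<ge> \<delta>\<close> below the level
    \<open>c\<close>: there the penalty would rise above \<open>m\<close> by more than
    \<open>c - m\<close>. The summand 1 in the last term makes \<open>\<mu> > L / r\<close>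
    strict.\<close>
  let ?\<mu>\<^sub>1 = "max 0 (max (\<mu>\<^sub>0 + (\<bar>c - m\<bar> + 1) / \<delta>) (L / r + 1))"
  \<comment> \<open>Nonnegativity is read off the Lipschitz bound: \<open>C * D y z\<close>
    dominates an absolute value.\<close>
  have D0: "0 \<le> D y z" if "y \<in> K" "z \<in> K" for y z
    using \<phi>_D[OF that] C by (smt (verit) mult_nonneg_nonpos zero_le_mult_iff)
  have feas: "\<exists>w\<in>K. \<phi> w = 0 \<and> f w \<le> f y + L / r * \<phi> y \<and> D w y \<le> \<kappa> / r * \<phi> y"
    if y: "y \<in> K" "N y \<le> M + 1" "0 < \<phi> y" for y
  proof -
    from desc[OF y] obtain g where g: "\<forall>a. 
         0 < a \<and> a \<le> \<phi> y / (\<phi> y + r) \<longrightarrow>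
         g a \<in> K \<and> f (g a) \<le> f y + a * L \<and> D (g a) y \<le> a * \<kappa> \<and>
         \<phi> (g a) = \<phi> y - a * (\<phi> y + r)" by blast
    define a where "a = \<phi> y / (\<phi> y + r)"
    have a: "0 < a" "a \<le> \<phi> y / (\<phi> y + r)" "a * (\<phi> y + r) = \<phi> y" "a \<le> \<phi> y / r"
      using y(3) pos(3) by (auto simp: a_def divide_simps intro!: mult_left_mono)
    have "a * L \<le> L / r * \<phi> y" "a * \<kappa> \<le> \<kappa> / r * \<phi> y"
      using mult_right_mono[OF a(4), of L] mult_right_mono[OF a(4), of \<kappa>] pos by (auto simp: mult.commute)
    with g a show ?thesis by (intro bexI[of _ "g a"]) (auto dest: spec[of _ a])
  qed
  show ?thesis
  proof (intro exI[of _ ?\<mu>\<^sub>1] conjI allI impI)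
    show "0 \<le> ?\<mu>\<^sub>1" by simp
    fix \<mu> assume "?\<mu>\<^sub>1 \<le> \<mu>"
    then have \<mu>: "\<mu> \<ge> 0" "\<mu> \<ge> \<mu>\<^sub>0 + (\<bar>c - m\<bar> + 1) / \<delta>" "\<mu> > L / r" by auto
    let ?\<Phi> = "penalty f \<phi> \<mu>" and ?\<Omega> = "feasible_set K \<phi>"
    let ?S = "sublevel K ?\<Phi> c"
    have \<mu>_L: "L / r * \<phi> y \<le> \<mu> * \<phi> y" for y
      using \<mu>(3) \<phi>_nonneg[of y] by (intro mult_right_mono) auto
    have \<mu>r: "L < \<mu> * r" using \<mu>(3) pos(3) by (simp add: pos_divide_less_eq)
    have \<Omega>: "y \<in> ?\<Omega> \<longleftrightarrow> y \<in> K \<and> \<phi> y = 0" for y by (simp add: feasible_set_def)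
    have \<Phi>_\<Omega>: "?\<Phi> y = f y" if "y \<in> ?\<Omega>" for y using that by (simp add: penalty_def \<Omega>)
    have NM: "N z \<le> M" if z: "z \<in> K" "?\<Phi> z < c" for z
    proof -
      have eq: "?\<Phi> z = penalty f \<phi> \<mu>\<^sub>0 z + (\<mu> - \<mu>\<^sub>0) * \<phi> z"
        by (simp add: penalty_def algebra_simps)
      have "0 < (\<bar>c - m\<bar> + 1) / \<delta>" using \<open>0 < \<delta>\<close> by simp
      then have "\<mu>\<^sub>0 < \<mu>" using \<mu>(2) by linarith
      then have "0 \<le> (\<mu> - \<mu>\<^sub>0) * \<phi> z" using \<phi>_nonneg by simp
      then have 1: "penalty f \<phi> \<mu>\<^sub>0 z < c" using eq z(2) by linarith
      have "\<phi> z < \<delta>"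
      proof (rule ccontr)
        assume "\<not> \<phi> z < \<delta>"
        then have "(\<bar>c - m\<bar> + 1) / \<delta> * \<delta> \<le> (\<mu> - \<mu>\<^sub>0) * \<phi> z"
          using \<mu>(2) \<open>0 < \<delta>\<close> \<open>\<mu>\<^sub>0 < \<mu>\<close> by (intro mult_mono) auto
        then show False using below[OF z(1)] eq z(2) \<open>0 < \<delta>\<close> by simp
      qed
      then show ?thesis using bounded z(1) 1 by blast
    qed
    have z0: "z0 \<in> ?\<Omega>" "\<And>y. y \<in> ?\<Omega> \<Longrightarrow> f z0 \<le> f y" 
      using opt by (auto simp: globally_optimal_def)
    have better: "\<exists>w\<in>?\<Omega>. f w \<le> f y + L / r * \<phi> y \<and> D w y \<le> \<kappa> / r * \<phi> y" 
      if "y \<in> K" "N y \<le> M + 1" for y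
    proof (cases "\<phi> y = 0")
      case True
      show ?thesis
      proof (intro bexI[of _ y])
        show "f y \<le> f y + L / r * \<phi> y \<and> D y y \<le> \<kappa> / r * \<phi> y" using True D_refl that by simp
      qed (use True that in \<open>simp add: \<Omega>\<close>)
    next
      case False
      then have "0 < \<phi> y" using \<phi>_nonneg[of y] by simp
      from feas[OF that this] show ?thesis by (auto simp: \<Omega>)
    qed
    have infeas: False if z: "z \<in> K" "?\<Phi> z < c" "0 < \<phi> z" 
      and st: "locally_optimal D ?\<Phi> K z \<or> inf_stationary D ?\<Phi> K z" for z
    proof -
      have "N z \<le> M + 1" using NM[OF z(1,2)] by simp
      from desc[OF z(1) this z(3)] obtain g where g: "\<And>a. 0 < a \<Longrightarrow> a \<le> \<phi> z / (\<phi> z + r) \<Longrightarrow>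
         g a \<in> K \<and> f (g a) \<le> f z + a * L \<and> D (g a) z \<le> a * \<kappa> \<and>
         \<phi> (g a) = \<phi> z - a * (\<phi> z + r)" by blast
      \<comment> \<open>Half the guaranteed rate of decrease: the penalty falls by at least
        \<open>\<mu> * r - L\<close> per unit of the segment parameter, while the displacement is at
        most \<open>\<kappa>\<close>. Local optimality and inf-stationarity both exclude rates
        beyond \<open>\<epsilon>\<close> near \<open>z\<close>, so one contradiction serves
        both.\<close>
      define \<epsilon> where "\<epsilon> = (\<mu> * r - L) / \<kappa> / 2"
      have \<epsilon>: "0 < \<epsilon>" using \<mu>r pos by (simp add: \<epsilon>_def)
      from st obtain \<rho> where \<rho>: "0 < \<rho>" 
        "\<And>y. y \<in> K \<Longrightarrow> 0 < D y z \<Longrightarrow> D y z < \<rho> \<Longrightarrow> - \<epsilon> * D y z \<le> ?\<Phi> y - ?\<Phi> z"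
      proof (elim disjE)
        assume "locally_optimal D ?\<Phi> K z"
        then obtain \<rho> where "0 < \<rho>" "\<And>y. y \<in> K \<Longrightarrow> D y z < \<rho> \<Longrightarrow> ?\<Phi> z \<le> ?\<Phi> y"
          by (auto simp: locally_optimal_def)
        then show ?thesis using \<epsilon> by (intro that[of \<rho>]) (auto simp: mult_nonneg_nonneg intro: order_trans[of _ 0])
      next
        assume "inf_stationary D ?\<Phi> K z"
        then show ?thesis using \<epsilon> unfolding inf_stationary_iff by (metis that)
      qed
      \<comment> \<open>The second bound keeps the displacement \<open>a * \<kappa>\<close> below
        \<open>\<rho>\<close>.\<close>
      define a where "a = min (\<phi> z / (\<phi> z + r)) (\<rho> / (2 * \<kappa>))"
      have a: "0 < a" "a \<le> \<phi> z / (\<phi> z + r)" "a \<le> \<rho> / (2 * \<kappa>)"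
        using z(3) pos \<rho>(1) by (auto simp: a_def)
      have "a * \<kappa> \<le> \<rho> / (2 * \<kappa>) * \<kappa>" using a(3) pos(1) by (intro mult_right_mono) auto
      also have "\<dots> = \<rho> / 2" using pos(1) by simp
      finally have a\<kappa>: "a * \<kappa> < \<rho>" using \<rho>(1) by simp
      from g[OF a(1,2)] have ga: "g a \<in> K" "f (g a) \<le> f z + a * L" "D (g a) z \<le> a * \<kappa>"
         "\<phi> (g a) = \<phi> z - a * (\<phi> z + r)" by auto
      have "0 < a * (\<phi> z + r)" using a(1) z(3) pos(3) by simp
      \<comment> \<open>Stationarity constrains only points at positive distance. Since
        \<open>\<phi>\<close> changes between \<open>z\<close> and \<open>g a\<close>, its Lipschitz
        bound forces the distance to be positive.\<close>
      then have "D (g a) z \<noteq> 0" using \<phi>_D[OF ga(1) z(1)] ga(4) by auto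
      then have D: "0 < D (g a) z" using D0[OF ga(1) z(1)] by simp
      have "?\<Phi> (g a) - ?\<Phi> z \<le> a * L - \<mu> * (a * (\<phi> z + r))"
        using ga(2) unfolding penalty_def ga(4) by (simp add: algebra_simps)
      also have "\<dots> \<le> a * L - \<mu> * (a * r)"
        using \<mu>(1) a(1) z(3) by (intro diff_left_mono mult_left_mono) auto
      also have "\<dots> = - (a * \<kappa>) * (2 * \<epsilon>)" using pos by (simp add: \<epsilon>_def field_simps)
      also have "\<dots> < - \<epsilon> * (a * \<kappa>)" using \<epsilon> a(1) pos(1) by simp
      also have "\<dots> \<le> - \<epsilon> * D (g a) z" using \<epsilon> ga(3) by simp
      finally show False using \<rho>(2)[OF ga(1) D] ga(3) a\<kappa> by linarith
    qed
    \<comment> \<open>At or above the level \<open>c\<close> this is \<open>f z0 < c\<close>. Below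
      it the norm bound holds, and the corrected feasible point costs no more than the penalty at
      \<open>y\<close>.\<close>
    have lower: "f z0 \<le> ?\<Phi> y" if "y \<in> K" for y
    proof (cases "?\<Phi> y < c")
      case True
      then have "N y \<le> M + 1" using NM that by force
      from better[OF that this] obtain w where "w \<in> ?\<Omega>" "f w \<le> f y + L / r * \<phi> y" by blast
      then show ?thesis using z0(2)[of w] \<mu>_L[of y] by (simp add: penalty_def)
    qed (use c in linarith)
    have glob: "globally_optimal ?\<Phi> K z \<longleftrightarrow> globally_optimal f ?\<Omega> z" for z
    proof
      assume z: "globally_optimal f ?\<Omega> z"
      then have "f z = f z0" using z0 by (intro order_antisym) (auto simp: globally_optimal_def)
      then show "globally_optimal ?\<Phi> K z"
        using z lower \<Phi>_\<Omega>[of z] by (auto simp: globally_optimal_def \<Omega>)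
    next
      assume z: "globally_optimal ?\<Phi> K z"
      then have zK: "z \<in> K" and min: "\<And>y. y \<in> K \<Longrightarrow> ?\<Phi> z \<le> ?\<Phi> y" by (auto simp: globally_optimal_def)
      have "?\<Phi> z < c" using min[of z0] z0(1) \<Phi>_\<Omega>[of z0] c by (auto simp: \<Omega>)
      moreover have "locally_optimal D ?\<Phi> K z"
        using zK min by (auto simp: locally_optimal_def intro: exI[of _ 1])
      ultimately have "\<phi> z = 0" using infeas[OF zK] \<phi>_nonneg[of z] by force
      then have "z \<in> ?\<Omega>" using zK by (simp add: \<Omega>)
      then show "globally_optimal f ?\<Omega> z"
        using min \<Phi>_\<Omega> unfolding globally_optimal_def by (metis \<Omega>)
    qed
    have val: "optimal_value f ?\<Omega> = optimal_value ?\<Phi> K"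
    proof -
      have "optimal_value f ?\<Omega> = ereal (f z0)"
        unfolding optimal_value_def using z0 by (intro INF_eqI) auto
      moreover have "optimal_value ?\<Phi> K = ereal (f z0)"
        unfolding optimal_value_def
      proof (intro INF_eqI)
        show "\<And>b. (\<And>i. i \<in> K \<Longrightarrow> b \<le> ereal (?\<Phi> i)) \<Longrightarrow> b \<le> ereal (f z0)"
          using z0(1) \<Phi>_\<Omega>[OF z0(1)] by (metis \<Omega>)
      qed (use lower in auto)
      ultimately show ?thesis by simp
    qed
    \<comment> \<open>The correction moves \<open>y\<close> by at most a multiple of
      \<open>\<phi> y\<close>, and \<open>\<phi> y \<le> C * D y z\<close> because
      \<open>\<phi> z = 0\<close>. Hence the distance to \<open>z\<close> grows at most by the fixed
      factor called \<open>k\<close> below.\<close>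
    have near: "\<exists>w\<in>?\<Omega>. f w \<le> f y + L / r * \<phi> y \<and> D w z \<le> (1 + \<kappa> / r * C) * D y z"
      if z: "z \<in> ?\<Omega>" "?\<Phi> z < c" and y: "y \<in> K" "D y z < 1" for y z
    proof -
      have zK: "z \<in> K" "\<phi> z = 0" using z(1) by (auto simp: \<Omega>)
      have "N y \<le> M + 1" using N_D[OF y(1) zK(1)] NM[OF zK(1) z(2)] y(2) by linarith
      from better[OF y(1) this] obtain w where 
        w: "w \<in> ?\<Omega>" "f w \<le> f y + L / r * \<phi> y" "D w y \<le> \<kappa> / r * \<phi> y" by blast
      have "\<phi> y \<le> C * D y z" using \<phi>_D[OF y(1) zK(1)] zK(2) by simp
      then have "\<kappa> / r * \<phi> y \<le> \<kappa> / r * (C * D y z)" using pos by (intro mult_left_mono) auto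
      moreover have "D w z \<le> D w y + D y z" using w(1) y(1) zK(1) by (intro D_tri) (auto simp: \<Omega>)
      ultimately show ?thesis using w by (intro bexI[of _ w]) (auto simp: algebra_simps)
    qed
    define k where "k = 1 + \<kappa> / r * C"
    have k: "1 \<le> k" using pos C by (simp add: k_def)
    note near = near[folded k_def]
    have loc: "locally_optimal D ?\<Phi> K z \<longleftrightarrow> z \<in> ?\<Omega> \<and> locally_optimal D f ?\<Omega> z" if "z \<in> ?S" for z
    proof
      have z: "z \<in> K" "?\<Phi> z < c" using that by (auto simp: sublevel_def)
      assume l: "locally_optimal D ?\<Phi> K z"
      then have "\<phi> z = 0" using infeas[OF z] \<phi>_nonneg[of z] by force
      then have "z \<in> ?\<Omega>" using z by (simp add: \<Omega>)
      then show "z \<in> ?\<Omega> \<and> locally_optimal D f ?\<Omega> z"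
        using l \<Phi>_\<Omega> unfolding locally_optimal_def by (metis \<Omega>)
    next
      have z: "z \<in> K" "?\<Phi> z < c" using that by (auto simp: sublevel_def)
      assume l: "z \<in> ?\<Omega> \<and> locally_optimal D f ?\<Omega> z"
      then obtain \<rho> where \<rho>: "0 < \<rho>" "\<And>w. w \<in> ?\<Omega> \<Longrightarrow> D w z < \<rho> \<Longrightarrow> f z \<le> f w"
        by (auto simp: locally_optimal_def)
      show "locally_optimal D ?\<Phi> K z"
        unfolding locally_optimal_def
      proof (intro conjI exI[of _ "min 1 (\<rho> / k)"] ballI impI z)
        show "0 < min 1 (\<rho> / k)" using \<rho>(1) k by simp
        fix y assume y: "y \<in> K" "D y z < min 1 (\<rho> / k)"
        then have "D y z < 1" by simp
        from near[OF _ z(2) y(1) this] l obtain w where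
          w: "w \<in> ?\<Omega>" "f w \<le> f y + L / r * \<phi> y" "D w z \<le> k * D y z" by blast
        have "k * D y z < \<rho>" using y(2) k by (simp add: pos_less_divide_eq mult.commute)
        then have "f z \<le> f w" using \<rho>(2) w by simp
        then show "?\<Phi> z \<le> ?\<Phi> y" using w(2) \<mu>_L[of y] l \<Omega>[of z] by (simp add: penalty_def)
      qed
    qed
    have stat: "inf_stationary D ?\<Phi> K z \<longleftrightarrow> z \<in> ?\<Omega> \<and> inf_stationary D f ?\<Omega> z" if "z \<in> ?S" for z
    proof
      have z: "z \<in> K" "?\<Phi> z < c" using that by (auto simp: sublevel_def)
      assume l: "inf_stationary D ?\<Phi> K z"
      then have "\<phi> z = 0" using infeas[OF z] \<phi>_nonneg[of z] by force
      then have "z \<in> ?\<Omega>" using z by (simp add: \<Omega>)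
      then show "z \<in> ?\<Omega> \<and> inf_stationary D f ?\<Omega> z"
        using l \<Phi>_\<Omega> unfolding inf_stationary_iff by (metis \<Omega>)
    next
      have z: "z \<in> K" "?\<Phi> z < c" using that by (auto simp: sublevel_def)
      assume l: "z \<in> ?\<Omega> \<and> inf_stationary D f ?\<Omega> z"
      show "inf_stationary D ?\<Phi> K z"
        unfolding inf_stationary_iff
      proof (intro conjI allI impI z)
        fix \<epsilon> :: real assume \<epsilon>: "0 < \<epsilon>"
        \<comment> \<open>The smaller tolerance offsets the factor \<open>k\<close> by which the
          correction may stretch the distance to \<open>z\<close>.\<close>
        then have "0 < \<epsilon> / k" using k by simp
        then obtain \<rho> where \<rho>: "0 < \<rho>" 
          "\<And>w. w \<in> ?\<Omega> \<Longrightarrow> 0 < D w z \<Longrightarrow> D w z < \<rho> \<Longrightarrow> - (\<epsilon> / k) * D w z \<le> f w - f z"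
          using l unfolding inf_stationary_iff by metis
        show "\<exists>\<rho>>0. \<forall>y\<in>K. 0 < D y z \<and> D y z < \<rho> \<longrightarrow> - \<epsilon> * D y z \<le> ?\<Phi> y - ?\<Phi> z"
        proof (intro exI[of _ "min 1 (\<rho> / k)"] conjI ballI impI)
          show "0 < min 1 (\<rho> / k)" using \<rho>(1) k by simp
          fix y assume y: "y \<in> K" "0 < D y z \<and> D y z < min 1 (\<rho> / k)"
          then have "D y z < 1" by simp
          from near[OF _ z(2) y(1) this] l obtain w where
            w: "w \<in> ?\<Omega>" "f w \<le> f y + L / r * \<phi> y" "D w z \<le> k * D y z" by blast
          have "k * D y z < \<rho>" using y(2) k by (simp add: pos_less_divide_eq mult.commute)
          then have Dw: "D w z < \<rho>" using w by simp
          have "- \<epsilon> * D y z \<le> f w - f z"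
          \<comment> \<open>The corrected point may be another representative of \<open>z\<close>,
            about which inf-stationarity on the feasible set is silent; there \<open>f_eq\<close>
            takes over.\<close>
          proof (cases "D w z = 0")
            case True
            then have "f w = f z" using w(1) z(1) by (intro f_eq) (auto simp: \<Omega>)
            then show ?thesis using \<epsilon> y(2) by simp
          next
            case False
            then have "0 < D w z" using D0[of w z] w(1) z(1) by (auto simp: \<Omega>)
            then have "- (\<epsilon> / k) * D w z \<le> f w - f z" using \<rho>(2) w(1) Dw by blast
            moreover have "(\<epsilon> / k) * D w z \<le> (\<epsilon> / k) * (k * D y z)" 
              using \<epsilon> k w(3) by (intro mult_left_mono) auto
            ultimately show ?thesis using k by simp
          qed
          then show "- \<epsilon> * D y z \<le> ?\<Phi> y - ?\<Phi> z"
            using w(2) \<mu>_L[of y] l \<Omega>[of z] by (simp add: penalty_def)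
        qed
      qed
    qed
    show "completely_exact D K f \<phi> \<mu> ?S"
      unfolding completely_exact_def using val glob loc stat by blast
  qed
qed

section \<open>Absolutely continuous functions\<close>

text \<open>Numbering the index set by a bijection frees the definition from indices
  \<open>{..<n}\<close>, so that it applies directly to the cells of a tagged division.\<close>

lemma abs_continuous_finite_family:
  fixes x :: "real \<Rightarrow> 'a::real_normed_vector"
  assumes "abs_continuous T x" "0 < \<epsilon>"
  shows "\<exists>\<delta>>0. \<forall>(P :: 'i set) a b. finite P \<and> (\<forall>i\<in>P. 0 \<le> a i \<and> a i \<le> b i \<and> b i \<le> T) \<and>
      disjoint_family_on (\<lambda>i. {a i<..<b i}) P \<and> (\<Sum>i\<in>P. b i - a i) < \<delta> \<longrightarrow>
      (\<Sum>i\<in>P. norm (x (b i) - x (a i))) < \<epsilon>"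
proof -
  obtain \<delta> where \<delta>: "0 < \<delta>" and *: "\<forall>(n::nat) a b.
        (\<forall>i<n. 0 \<le> a i \<and> a i \<le> b i \<and> b i \<le> T) \<and>
        disjoint_family_on (\<lambda>i. {a i<..<b i}) {..<n} \<and>
        (\<Sum>i<n. b i - a i) < \<delta> \<longrightarrow> (\<Sum>i<n. norm (x (b i) - x (a i))) < \<epsilon>"
    using assms(1)[unfolded abs_continuous_def, rule_format, OF assms(2)] by (elim exE conjE) (rule that)
  show ?thesis
  proof (intro exI[of _ \<delta>] conjI allI impI \<delta>)
    fix P :: "'i set" and a b
    assume "finite P \<and> (\<forall>i\<in>P. 0 \<le> a i \<and> a i \<le> b i \<and> b i \<le> T) \<and>
      disjoint_family_on (\<lambda>i. {a i<..<b i}) P \<and> (\<Sum>i\<in>P. b i - a i) < \<delta>"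
    then have P: "finite P" "\<forall>i\<in>P. 0 \<le> a i \<and> a i \<le> b i \<and> b i \<le> T"
      "disjoint_family_on (\<lambda>i. {a i<..<b i}) P" "(\<Sum>i\<in>P. b i - a i) < \<delta>" by auto
    obtain h where h: "bij_betw h {..<card P} P"
      using ex_bij_betw_nat_finite[OF P(1)] by (auto simp: lessThan_atLeast0)
    then have hP: "h i \<in> P" if "i < card P" for i using that by (auto simp: bij_betw_def)
    have "(\<Sum>i<card P. norm (x (b (h i)) - x (a (h i)))) < \<epsilon>"
    proof (rule *[rule_format, OF conjI[OF _ conjI]])
      show "disjoint_family_on (\<lambda>i. {a (h i)<..<b (h i)}) {..<card P}"
        unfolding disjoint_family_on_def
      proof (intro ballI impI)
        fix i j assume ij: "i \<in> {..<card P}" "j \<in> {..<card P}" "i \<noteq> j"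
        then have "h i \<noteq> h j" using h by (auto simp: bij_betw_def inj_on_def)
        then show "{a (h i)<..<b (h i)} \<inter> {a (h j)<..<b (h j)} = {}"
          using P(3) hP ij(1,2) unfolding disjoint_family_on_def by blast
      qed
      show "(\<Sum>i<card P. b (h i) - a (h i)) < \<delta>"
        using P(4) sum.reindex_bij_betw[OF h, of "\<lambda>i. b i - a i"] by simp
    qed (use P(2) hP in blast)
    then show "(\<Sum>i\<in>P. norm (x (b i) - x (a i))) < \<epsilon>"
      using sum.reindex_bij_betw[OF h, of "\<lambda>i. norm (x (b i) - x (a i))"] by simp
  qed
qed

lemma abs_continuous_imp_continuous_on:
  assumes "abs_continuous T x"
  shows "continuous_on {0..T} x"
  unfolding continuous_on_iff
proof (intro ballI allI impI)
  fix s \<epsilon> :: real assume s: "s \<in> {0..T}" and "0 < \<epsilon>"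
  obtain \<delta> where \<delta>: "0 < \<delta>" 
    "\<And>P a b. finite P \<Longrightarrow> \<forall>i::unit\<in>P. 0 \<le> a i \<and> a i \<le> b i \<and> b i \<le> T \<Longrightarrow>
      disjoint_family_on (\<lambda>i. {a i<..<b i}) P \<Longrightarrow> (\<Sum>i\<in>P. b i - a i) < \<delta> \<Longrightarrow>
      (\<Sum>i\<in>P. norm (x (b i) - x (a i))) < \<epsilon>"
    using abs_continuous_finite_family[OF assms \<open>0 < \<epsilon>\<close>, where ?'i = unit]
    by (elim exE conjE) (rule that, assumption, simp)
  show "\<exists>d>0. \<forall>t\<in>{0..T}. dist t s < d \<longrightarrow> dist (x t) (x s) < \<epsilon>"
  proof (intro exI[of _ \<delta>] conjI ballI impI \<delta>(1))
    fix t assume t: "t \<in> {0..T}" "dist t s < \<delta>"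
    have "(\<Sum>i\<in>{()}. norm (x (max s t) - x (min s t))) < \<epsilon>"
      by (rule \<delta>(2)) (use s t in \<open>auto simp: disjoint_family_on_def dist_real_def\<close>)
    then show "dist (x t) (x s) < \<epsilon>"
      by (simp add: dist_norm max_def min_def norm_minus_commute split: if_splits)
  qed
qed

text \<open>Cells may share endpoints, but their interiors are disjoint, have the same lengths and
  lie in \<open>G\<close>.\<close>

lemma sum_length_tagged_le:
  assumes p: "p tagged_partial_division_of cbox a b" and G: "G \<in> lmeasurable"
    and sub: "\<And>t k. (t, k) \<in> p \<Longrightarrow> k \<subseteq> (G :: real set)"
  shows "(\<Sum>(t, k)\<in>p. measure lborel k) \<le> measure lebesgue G"
proof -
  have fin: "finite p" using p by (auto simp: tagged_partial_division_of_def)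
  have int: "measure lebesgue (interior k) = measure lborel k \<and> interior k \<in> lmeasurable" if "(t, k) \<in> p" for t k
  proof -
    from p that obtain u v where "k = cbox u v" unfolding tagged_partial_division_of_def by blast
    then show ?thesis by (auto simp: content_real_if)
  qed
  have "(\<Sum>(t, k)\<in>p. measure lborel k) = (\<Sum>y\<in>p. measure lebesgue (interior (snd y)))"
    using int by (intro sum.cong) auto
  also have "\<dots> = measure lebesgue (\<Union>y\<in>p. interior (snd y))"
  proof (rule measure_UNION'[symmetric])
    show "pairwise (\<lambda>i j. disjnt (interior (snd i)) (interior (snd j))) p"
      unfolding pairwise_def disjnt_def
    proof (intro ballI impI)
      fix i j assume "i \<in> p" "j \<in> p" "i \<noteq> j"
      then show "interior (snd i) \<inter> interior (snd j) = {}"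
        using tagged_partial_division_ofD(5)[OF p, of "fst i" "snd i" "fst j" "snd j"] by simp
    qed
  qed (use fin int in auto)
  also have "\<dots> \<le> measure lebesgue G"
  proof (rule measure_mono_fmeasurable[OF _ _ G])
    show "(\<Union>y\<in>p. interior (snd y)) \<subseteq> G"
    proof (rule UN_least)
      fix y assume "y \<in> p"
      then show "interior (snd y) \<subseteq> G" using sub[of "fst y" "snd y"] interior_subset[of "snd y"] by auto
    qed
    show "(\<Union>y\<in>p. interior (snd y)) \<in> sets lebesgue"
      using fin int by (intro sets.finite_UN) auto
  qed
  finally show ?thesis .
qed

text \<open>
  The null set on which \<open>x\<close> is not differentiable with derivative \<open>g\<close> is covered by an open set so small
  that, by absolute continuity, the cells of a tagged division with tags in it contribute little.
\<close>

theorem abs_continuous_fundamental_theorem: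
  fixes x :: "real \<Rightarrow> 'a::euclidean_space"
  assumes ac: "abs_continuous T x" and b: "0 \<le> b" "b \<le> T"
    and der: "AE t in lebesgue_on {0..T}. (x has_vector_derivative g t) (at t within {0..T})"
  shows "(g has_integral (x b - x 0)) {0..b}"
proof -
  obtain N where N: "N \<in> null_sets lebesgue" 
    "\<And>t. t \<in> {0..T} - N \<Longrightarrow> (x has_vector_derivative g t) (at t within {0..T})"
  proof -
    have "AE t in lebesgue. t \<in> {0..T} \<longrightarrow> (x has_vector_derivative g t) (at t within {0..T})"
      using der by (subst (asm) AE_restrict_space_iff) auto
    then show thesis by (auto elim!: AE_E3 intro: that)
  qed
  \<comment> \<open>Setting the integrand to 0 on \<open>N\<close> removes cells with tags in
    \<open>N\<close> from the Riemann sum, leaving only their increments of \<open>x\<close> to be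
    estimated. The null set does not affect the integral.\<close>
  define g' where "g' t = (if t \<in> N then 0 else g t)" for t
  have "(g' has_integral (x b - x 0)) {0..b}"
    unfolding has_integral_real
  proof (intro allI impI)
    fix \<epsilon> :: real assume \<epsilon>: "0 < \<epsilon>"
    note acf = abs_continuous_finite_family[OF ac half_gt_zero[OF \<epsilon>], where ?'i = "real \<times> real set"]
    obtain \<delta> where \<delta>: "0 < \<delta>" 
      "\<And>P u v. finite P \<Longrightarrow> \<forall>i::real \<times> real set\<in>P. 0 \<le> u i \<and> u i \<le> v i \<and> v i \<le> T \<Longrightarrow>
      disjoint_family_on (\<lambda>i. {u i<..<v i}) P \<Longrightarrow> (\<Sum>i\<in>P. v i - u i) < \<delta> \<Longrightarrow>
      (\<Sum>i\<in>P. norm (x (v i) - x (u i))) < \<epsilon> / 2"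
      using acf by (elim exE conjE) (rule that, assumption, simp)
    obtain G where G: "open G" "N \<subseteq> G" "G - N \<in> lmeasurable" "emeasure lebesgue (G - N) < ennreal \<delta>"
      using sets_lebesgue_outer_open[OF null_setsD2[OF N(1)] \<delta>(1)] by blast
    have GN: "emeasure lebesgue G = emeasure lebesgue (G - N)"
      using N(1) G(1) by (intro emeasure_Diff_null_set[symmetric]) auto
    have Gm: "G \<in> lmeasurable" 
      using G GN by (intro fmeasurableI) (auto simp: top.not_eq_extremum intro: less_trans)
    have "measure lebesgue G < \<delta>"
      using G(4) emeasure_eq_measure2[OF Gm] by (simp add: GN[symmetric] ennreal_less_iff)
    \<comment> \<open>The cells with tags outside \<open>N\<close> contribute at most
      \<open>e * b < \<epsilon> / 2\<close> in total; the summand 1 covers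
      \<open>b = 0\<close>.\<close>
    define e where "e = \<epsilon> / (2 * (b + 1))"
    have e: "0 < e" using \<epsilon> b by (simp add: e_def)
    have eb: "e * b < \<epsilon> / 2" using \<epsilon> b by (simp add: e_def field_simps)
    \<comment> \<open>This is the gauge: around a tag in \<open>N\<close> it keeps the cell inside
      \<open>G\<close>, around any other tag in the interval it makes the linear approximation
      accurate to \<open>e\<close>.\<close>
    have "\<exists>d>0. (t \<in> N \<longrightarrow> ball t d \<subseteq> G) \<and> (t \<in> {0..T} - N \<longrightarrow> 
        (\<forall>y\<in>{0..T}. norm (y - t) < d \<longrightarrow> norm (x y - x t - (y - t) *\<^sub>R g t) \<le> e * norm (y - t)))" for t
    proof (cases "t \<in> N")
      case True
      then show ?thesis using G(1,2) open_contains_ball by blast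
    next
      case False
      show ?thesis
      proof (cases "t \<in> {0..T}")
        case True
        then have "(x has_vector_derivative g t) (at t within {0..T})" using N False by blast
        then show ?thesis
          using e False unfolding has_vector_derivative_def has_derivative_within_alt by blast
      qed (use False in \<open>auto intro: exI[of _ 1]\<close>)
    qed
    then obtain d where d: "\<And>t. 0 < d t" "\<And>t. t \<in> N \<Longrightarrow> ball t (d t) \<subseteq> G"
      "\<And>t y. t \<in> {0..T} - N \<Longrightarrow> y \<in> {0..T} \<Longrightarrow> norm (y - t) < d t \<Longrightarrow> 
         norm (x y - x t - (y - t) *\<^sub>R g t) \<le> e * norm (y - t)" by metis
    show "\<exists>\<gamma>. gauge \<gamma> \<and> (\<forall>p. p tagged_division_of {0..b} \<and> \<gamma> fine p \<longrightarrow>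
        norm ((\<Sum>(t, k)\<in>p. measure lborel k *\<^sub>R g' t) - (x b - x 0)) < \<epsilon>)"
    proof (intro exI[of _ "\<lambda>t. ball t (d t)"] conjI allI impI)
      show "gauge (\<lambda>t. ball t (d t))" using d(1) gauge_ball_dependent by blast
      fix p assume "p tagged_division_of {0..b} \<and> (\<lambda>t. ball t (d t)) fine p"
      then have p: "p tagged_division_of cbox 0 b" and fine: "(\<lambda>t. ball t (d t)) fine p" by auto
      have fin: "finite p" using p by blast
      have cell: "t \<in> k \<and> k = {Inf k..Sup k} \<and> Inf k \<le> Sup k \<and> 0 \<le> Inf k \<and> Sup k \<le> b \<and> k \<subseteq> ball t (d t)
          \<and> measure lborel k = Sup k - Inf k"
        if "(t, k) \<in> p" for t k
      proof -
        from p that obtain u v where "k = cbox u v" "t \<in> k" "k \<subseteq> cbox 0 b" by blast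
        moreover have "k \<subseteq> ball t (d t)" using fine that by blast
        ultimately show ?thesis by auto
      qed
      let ?P = "{y \<in> p. fst y \<in> N}"
      let ?h = "\<lambda>y. x (Sup (snd y)) - x (Inf (snd y))"
      have tot: "x b - x 0 = (\<Sum>y\<in>p. ?h y)" "b - 0 = (\<Sum>y\<in>p. measure lborel (snd y))"
      proof -
        show "x b - x 0 = (\<Sum>y\<in>p. ?h y)"
          using additive_tagged_division_1[of 0 b p x] p b by (simp add: case_prod_beta')
        have "b - 0 = (\<Sum>y\<in>p. Sup (snd y) - Inf (snd y))"
          using additive_tagged_division_1[of 0 b p "\<lambda>x. x"] p b by (simp add: case_prod_beta')
        also have "\<dots> = (\<Sum>y\<in>p. measure lborel (snd y))" using cell by (intro sum.cong) auto
        finally show "b - 0 = (\<Sum>y\<in>p. measure lborel (snd y))" .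
      qed
      have partial: "?P tagged_partial_division_of cbox 0 b"
        by (rule tagged_partial_division_subset[of p]) (use p[unfolded tagged_division_of_def] in blast)+
      have "k \<subseteq> G" if "(t, k) \<in> ?P" for t k
        using cell[of t k] d(2)[of t] that by auto
      from sum_length_tagged_le[OF partial Gm this]
      have "(\<Sum>y\<in>?P. measure lborel (snd y)) \<le> measure lebesgue G"
        by (simp only: case_prod_beta')
      then have "(\<Sum>y\<in>?P. Sup (snd y) - Inf (snd y)) < \<delta>"
        using \<open>measure lebesgue G < \<delta>\<close> cell by (subst sum.cong[OF refl, of ?P _ "\<lambda>y. measure lborel (snd y)"]) auto
      moreover have "disjoint_family_on (\<lambda>y. {Inf (snd y)<..<Sup (snd y)}) ?P"
        unfolding disjoint_family_on_def
      proof (intro ballI impI)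
        fix y z assume yz: "y \<in> ?P" "z \<in> ?P" "y \<noteq> z"
        have "interior (snd w) = {Inf (snd w)<..<Sup (snd w)}" if "w \<in> ?P" for w
        proof -
          have "snd w = {Inf (snd w)..Sup (snd w)}" using cell[of "fst w" "snd w"] that by simp
          then show ?thesis using interior_atLeastAtMost_real[of "Inf (snd w)" "Sup (snd w)"] by simp
        qed
        moreover have "interior (snd y) \<inter> interior (snd z) = {}"
          using tagged_partial_division_ofD(5)[OF partial, of "fst y" "snd y" "fst z" "snd z"] yz by simp
        ultimately show "{Inf (snd y)<..<Sup (snd y)} \<inter> {Inf (snd z)<..<Sup (snd z)} = {}"
          using yz by simp
      qed
      ultimately have bad: "(\<Sum>y\<in>?P. norm (?h y)) < \<epsilon> / 2"
      proof (intro \<delta>(2))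
        show "\<forall>y\<in>?P. 0 \<le> Inf (snd y) \<and> Inf (snd y) \<le> Sup (snd y) \<and> Sup (snd y) \<le> T"
        proof
          fix y assume "y \<in> ?P"
          then show "0 \<le> Inf (snd y) \<and> Inf (snd y) \<le> Sup (snd y) \<and> Sup (snd y) \<le> T"
            using cell[of "fst y" "snd y"] b by auto
        qed
      qed (use fin in auto)
      have good: "norm (measure lborel (snd y) *\<^sub>R g' (fst y) - ?h y) \<le> e * measure lborel (snd y)" if y: "y \<in> p - ?P" for y
      proof -
        obtain t k where tk: "y = (t, k)" by (cases y)
        define u v where "u = Inf k" and "v = Sup k"
        have c: "t \<in> k" "k = {u..v}" "u \<le> v" "0 \<le> u" "v \<le> b" "k \<subseteq> ball t (d t)" "measure lborel k = v - u" "t \<notin> N"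
          using cell[of t k] y tk by (auto simp: u_def v_def)
        have t: "t \<in> {0..T} - N" "u \<le> t" "t \<le> v" using c b by auto
        have uv: "u \<in> ball t (d t)" "v \<in> ball t (d t)" using c(2,3,6) by force+
        have le: "norm (x u - x t - (u - t) *\<^sub>R g t) \<le> e * norm (u - t)"
          "norm (x v - x t - (v - t) *\<^sub>R g t) \<le> e * norm (v - t)"
          using d(3)[OF t(1), of u] d(3)[OF t(1), of v] uv c b by (auto simp: dist_norm norm_minus_commute)
        \<comment> \<open>The straddle argument: the increment is split at the tag. As
          \<open>u \<le> t \<le> v\<close>, the two errors add up to \<open>e\<close> times the
          length of the cell.\<close>
        have eq: "measure lborel k *\<^sub>R g t - (x v - x u) = 
            (x u - x t - (u - t) *\<^sub>R g t) - (x v - x t - (v - t) *\<^sub>R g t)"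
          unfolding c(7) by (simp add: algebra_simps)
        have "norm (measure lborel k *\<^sub>R g t - (x v - x u)) \<le> e * norm (u - t) + e * norm (v - t)"
          unfolding eq by (rule order_trans[OF norm_triangle_ineq4 add_mono[OF le]])
        also have "\<dots> = e * measure lborel k" unfolding c(7) using t by (simp add: algebra_simps)
        finally show ?thesis using tk c(8) by (simp add: g'_def u_def v_def)
      qed
      have "(\<Sum>(t, k)\<in>p. measure lborel k *\<^sub>R g' t) - (x b - x 0) = 
          (\<Sum>y\<in>p. measure lborel (snd y) *\<^sub>R g' (fst y) - ?h y)"
        using tot(1) by (simp add: sum_subtractf case_prod_beta')
      also have "\<dots> = (\<Sum>y\<in>p - ?P. measure lborel (snd y) *\<^sub>R g' (fst y) - ?h y) + 
          (\<Sum>y\<in>?P. measure lborel (snd y) *\<^sub>R g' (fst y) - ?h y)"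
        using fin by (intro sum.subset_diff) auto
      also have "(\<Sum>y\<in>?P. measure lborel (snd y) *\<^sub>R g' (fst y) - ?h y) = (\<Sum>y\<in>?P. - ?h y)"
        by (intro sum.cong) (auto simp: g'_def)
      finally have "norm ((\<Sum>(t, k)\<in>p. measure lborel k *\<^sub>R g' t) - (x b - x 0)) =
          norm ((\<Sum>y\<in>p - ?P. measure lborel (snd y) *\<^sub>R g' (fst y) - ?h y) + (\<Sum>y\<in>?P. - ?h y))"
        by (rule arg_cong)
      also have "\<dots> \<le>
          (\<Sum>y\<in>p - ?P. e * measure lborel (snd y)) + (\<Sum>y\<in>?P. norm (?h y))"
        using good by (intro order_trans[OF norm_triangle_ineq] add_mono sum_norm_le) (auto simp: norm_minus_commute)
      also have "(\<Sum>y\<in>p - ?P. e * measure lborel (snd y)) \<le> e * b"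
      proof -
        have "(\<Sum>y\<in>p - ?P. e * measure lborel (snd y)) \<le> (\<Sum>y\<in>p. e * measure lborel (snd y))"
          using fin e by (intro sum_mono2) auto
        then show ?thesis using tot(2) by (simp add: sum_distrib_left[symmetric])
      qed
      finally show "norm ((\<Sum>(t, k)\<in>p. measure lborel k *\<^sub>R g' t) - (x b - x 0)) < \<epsilon>"
        using bad eb by simp
    qed
  qed
  then show ?thesis
    by (rule has_integral_spike[of N, rotated 2]) (use N(1) in \<open>auto simp: g'_def negligible_iff_null_sets\<close>)
qed

section \<open>Lebesgue spaces\<close>

text \<open>Completeness of Lebesgue measure: preimages under \<open>u\<close> and \<open>v\<close>
  differ only inside a null set, all of whose subsets are measurable.\<close>

lemma borel_measurable_lebesgue_on_AE_cong:
  fixes u v :: "real \<Rightarrow> 'a::real_normed_vector"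
  assumes u: "u \<in> borel_measurable (lebesgue_on {0..T})" and eq: "AE t in lebesgue_on {0..T}. u t = v t"
  shows "v \<in> borel_measurable (lebesgue_on {0..T})"
proof (rule borel_measurableI)
  fix S :: "'a set" assume "open S"
  let ?M = "lebesgue_on {0..T}"
  from eq obtain N where N: "N \<in> null_sets ?M" "\<And>t. t \<in> space ?M - N \<Longrightarrow> u t = v t"
    by (auto elim!: AE_E3)
  have sub: "A \<in> sets ?M" if "A \<subseteq> N" for A
    using N(1) that null_sets_restrict_space[of "{0..T}" lebesgue] negligible_subset[of N A]
    by (auto simp: sets_restrict_space_iff negligible_iff_null_sets)
  have "v -` S \<inter> space ?M = (u -` S \<inter> space ?M - N) \<union> (v -` S \<inter> space ?M \<inter> N)"
    using N(2) by auto
  also have "\<dots> \<in> sets ?M"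
    using \<open>open S\<close> by (intro sets.Un[OF sets.Diff sub] measurable_sets[OF u] null_setsD2[OF N(1)] borel_open) auto
  finally show "v -` S \<inter> space ?M \<in> sets ?M" .
qed

text \<open>For positive arguments this is convexity of the power function; if one argument
  vanishes, it reduces to \<open>t powr p \<le> t\<close> for \<open>t\<close> in the unit
  interval.\<close>

lemma powr_convex_comb:
  fixes a b s p :: real
  assumes "1 \<le> p" "0 \<le> a" "0 \<le> b" "0 \<le> s" "s \<le> 1"
  shows "((1 - s) * a + s * b) powr p \<le> (1 - s) * a powr p + s * b powr p"
proof -
  have scale: "(t * c) powr p \<le> t * c powr p" if "0 \<le> t" "t \<le> 1" "0 \<le> c" for t c :: real
  proof (cases "t = 0")
    case False
    have "t powr p \<le> t powr 1" using that False assms(1) by (intro powr_mono') auto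
    then have "t powr p * c powr p \<le> t * c powr p" using that by (intro mult_right_mono) auto
    then show ?thesis using that by (simp add: powr_mult)
  qed simp
  consider "a = 0" | "b = 0" | "0 < a" "0 < b" using assms by linarith
  then show ?thesis
  proof cases
    case 3
    then show ?thesis
      using convex_onD[OF powr_convex[OF assms(1)], of s a b] assms by simp
  qed (use scale[of s b] scale[of "1 - s" a] assms in auto)
qed

lemma Lp_infinity_iff:
  "u \<in> Lp \<infinity> T \<longleftrightarrow> u \<in> borel_measurable (lebesgue_on {0..T}) \<and>
     (\<exists>C. AE t in lebesgue_on {0..T}. norm (u t) \<le> C)"
proof
  assume u: "u \<in> Lp \<infinity> T"
  let ?s = "esssup (lebesgue_on {0..T}) (\<lambda>t. ereal (norm (u t)))"
  have "?s < \<infinity>" using u by (simp add: Lp_def)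
  then obtain C where "?s \<le> ereal C" by (cases ?s) (auto intro: that[of 0] that)
  note C = this
  have "AE t in lebesgue_on {0..T}. ereal (norm (u t)) \<le> ?s" by (rule esssup_AE)
  then have "AE t in lebesgue_on {0..T}. norm (u t) \<le> C"
    by eventually_elim (metis C ereal_less_eq(3) order_trans)
  then show "u \<in> borel_measurable (lebesgue_on {0..T}) \<and> (\<exists>C. AE t in lebesgue_on {0..T}. norm (u t) \<le> C)"
    using u by (auto simp: Lp_def)
next
  assume u: "u \<in> borel_measurable (lebesgue_on {0..T}) \<and> (\<exists>C. AE t in lebesgue_on {0..T}. norm (u t) \<le> C)"
  then obtain C where C: "AE t in lebesgue_on {0..T}. norm (u t) \<le> C" by blast
  have "esssup (lebesgue_on {0..T}) (\<lambda>t. ereal (norm (u t))) \<le> ereal C"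
    using u C by (intro esssup_I) auto
  then show "u \<in> Lp \<infinity> T" using u by (auto simp: Lp_def intro: le_less_trans)
qed

lemma Lp_norm_infinity_le:
  assumes "u \<in> Lp \<infinity> T" "0 < T"
  shows "Lp_norm \<infinity> T u \<le> C \<longleftrightarrow> (AE t in lebesgue_on {0..T}. norm (u t) \<le> C)"
    and "0 \<le> Lp_norm \<infinity> T u"
proof -
  let ?s = "esssup (lebesgue_on {0..T}) (\<lambda>t. ereal (norm (u t)))"
  have um: "u \<in> borel_measurable (lebesgue_on {0..T})" and lt: "?s < \<infinity>" 
    using assms by (auto simp: Lp_def)
  \<comment> \<open>Positive length of the interval keeps the essential supremum nonnegative;
    together with finiteness, nothing is lost in the conversion to a real number.\<close>
  have "0 = esssup (lebesgue_on {0..T}) (\<lambda>t. 0 :: ereal)"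
    using \<open>0 < T\<close> by (subst esssup_const) (auto simp: emeasure_restrict_space)
  also have "\<dots> \<le> ?s" by (rule esssup_mono) auto
  finally have ge: "0 \<le> ?s" .
  then have s: "?s = ereal (Lp_norm \<infinity> T u)"
    using lt by (auto simp: Lp_norm_def ereal_real)
  show "0 \<le> Lp_norm \<infinity> T u" using ge unfolding s by simp
  show "Lp_norm \<infinity> T u \<le> C \<longleftrightarrow> (AE t in lebesgue_on {0..T}. norm (u t) \<le> C)"
  proof
    assume C: "Lp_norm \<infinity> T u \<le> C"
    have "AE t in lebesgue_on {0..T}. ereal (norm (u t)) \<le> ?s" by (rule esssup_AE)
    then show "AE t in lebesgue_on {0..T}. norm (u t) \<le> C"
      unfolding s by eventually_elim (use C in simp)
  next
    assume "AE t in lebesgue_on {0..T}. norm (u t) \<le> C"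
    then have "?s \<le> ereal C" using um by (intro esssup_I) auto
    then show "Lp_norm \<infinity> T u \<le> C" unfolding s by simp
  qed
qed

lemma ereal_ge_1_cases:
  assumes "1 \<le> (q :: ereal)"
  obtains "q = \<infinity>" | r where "q = ereal r" "1 \<le> r"
  using assms by (cases q) (auto simp: one_ereal_def)

lemma Lp_finite_iff:
  "u \<in> Lp (ereal r) T \<longleftrightarrow> u \<in> borel_measurable (lebesgue_on {0..T}) \<and>
     integrable (lebesgue_on {0..T}) (\<lambda>t. norm (u t) powr r)"
  by (simp add: Lp_def)

text \<open>Without the outer root, norm bounds can be proved on the integral itself, which is
  linear and monotone.\<close>

lemma Lp_norm_finite_le:
  assumes "1 \<le> r" "0 \<le> C"
  shows "Lp_norm (ereal r) T u \<le> C \<longleftrightarrow> (LINT t|lebesgue_on {0..T}. norm (u t) powr r) \<le> C powr r"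
proof -
  let ?i = "LINT t|lebesgue_on {0..T}. norm (u t) powr r"
  have i: "0 \<le> ?i" by (intro Bochner_Integration.integral_nonneg) auto
  have "?i powr (1 / r) \<le> C \<longleftrightarrow> ?i \<le> C powr r"
  proof
    assume "?i powr (1 / r) \<le> C"
    then have "(?i powr (1 / r)) powr r \<le> C powr r" using assms by (intro powr_mono2) auto
    then show "?i \<le> C powr r" using i assms by (simp add: powr_powr)
  next
    assume "?i \<le> C powr r"
    then have "?i powr (1 / r) \<le> (C powr r) powr (1 / r)" using assms i by (intro powr_mono2) auto
    then show "?i powr (1 / r) \<le> C" using assms by (simp add: powr_powr)
  qed
  then show ?thesis by (simp add: Lp_norm_def)
qed

lemma Lp_norm_nonneg: "1 \<le> q \<Longrightarrow> 0 < T \<Longrightarrow> u \<in> Lp q T \<Longrightarrow> 0 \<le> Lp_norm q T u"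
  using Lp_norm_infinity_le(2)[of u T] by (cases "q = \<infinity>") (auto simp: Lp_norm_def)

lemma Lp_measurable: "u \<in> Lp q T \<Longrightarrow> u \<in> borel_measurable (lebesgue_on {0..T})"
  by (simp add: Lp_def)

lemma Lp_AE_cong:
  fixes u v :: "real \<Rightarrow> 'a::real_normed_vector"
  assumes u: "u \<in> Lp q T" and eq: "AE t in lebesgue_on {0..T}. u t = v t"
  shows "v \<in> Lp q T" and "Lp_norm q T v = Lp_norm q T u"
proof -
  let ?M = "lebesgue_on {0..T}"
  have um: "u \<in> borel_measurable ?M" using u by (rule Lp_measurable)
  have vm: "v \<in> borel_measurable ?M" by (rule borel_measurable_lebesgue_on_AE_cong[OF um eq])
  have 1: "esssup ?M (\<lambda>t. ereal (norm (v t))) = esssup ?M (\<lambda>t. ereal (norm (u t)))"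
    using um vm eq by (intro esssup_AE_cong) auto
  have 2: "integrable ?M (\<lambda>t. norm (v t) powr r) \<longleftrightarrow> integrable ?M (\<lambda>t. norm (u t) powr r)" for r
    using um vm eq by (intro integrable_cong_AE) auto
  have 3: "(LINT t|?M. norm (v t) powr r) = (LINT t|?M. norm (u t) powr r)" for r
    using um vm eq by (intro integral_cong_AE) auto
  show "v \<in> Lp q T" "Lp_norm q T v = Lp_norm q T u"
    using u vm by (cases "q = \<infinity>"; simp add: Lp_def Lp_norm_def 1 2 3)+
qed

text \<open>One inequality, valid for every factor, is enough: applied to the inverse factor it
  yields the converse.\<close>

lemma Lp_scaleR:
  fixes u :: "real \<Rightarrow> 'a::real_normed_vector"
  assumes q: "1 \<le> q" and "0 < T" and u: "u \<in> Lp q T"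
  shows "(\<lambda>t. c *\<^sub>R u t) \<in> Lp q T" and "Lp_norm q T (\<lambda>t. c *\<^sub>R u t) = \<bar>c\<bar> * Lp_norm q T u"
proof -
  have main: "(\<lambda>t. c *\<^sub>R u t) \<in> Lp q T \<and> Lp_norm q T (\<lambda>t. c *\<^sub>R u t) \<le> \<bar>c\<bar> * Lp_norm q T u"
    if u: "u \<in> Lp q T" for c and u :: "real \<Rightarrow> 'a"
  proof (cases rule: ereal_ge_1_cases[OF q])
    case 1
    note um[measurable] = Lp_measurable[OF u]
    have "AE t in lebesgue_on {0..T}. norm (u t) \<le> Lp_norm \<infinity> T u"
      using Lp_norm_infinity_le(1) u 1 \<open>0 < T\<close> by blast
    then have *: "AE t in lebesgue_on {0..T}. norm (c *\<^sub>R u t) \<le> \<bar>c\<bar> * Lp_norm \<infinity> T u"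
      by eventually_elim (simp add: mult_left_mono)
    then have "(\<lambda>t. c *\<^sub>R u t) \<in> Lp \<infinity> T" unfolding Lp_infinity_iff by auto
    then show ?thesis using * Lp_norm_infinity_le(1) \<open>0 < T\<close> 1 by blast
  next
    case (2 r)
    note um[measurable] = Lp_measurable[OF u]
    have "integrable (lebesgue_on {0..T}) (\<lambda>t. \<bar>c\<bar> powr r * norm (u t) powr r)"
      using u 2 by (simp add: Lp_finite_iff)
    moreover have "(LINT t|lebesgue_on {0..T}. \<bar>c\<bar> powr r * norm (u t) powr r) powr (1 / r) = 
        \<bar>c\<bar> * (LINT t|lebesgue_on {0..T}. norm (u t) powr r) powr (1 / r)"
    proof -
      have "(\<bar>c\<bar> powr r) powr (1 / r) = \<bar>c\<bar>" using 2 by (simp add: powr_powr)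
      then show ?thesis by (simp add: powr_mult)
    qed
    moreover have "(\<bar>c\<bar> powr r) powr (1 / r) = \<bar>c\<bar>" using 2 by (simp add: powr_powr)
    ultimately show ?thesis using 2 u by (simp add: Lp_finite_iff Lp_norm_def powr_mult)
  qed
  show 1: "(\<lambda>t. c *\<^sub>R u t) \<in> Lp q T" using main[OF u] by blast
  show "Lp_norm q T (\<lambda>t. c *\<^sub>R u t) = \<bar>c\<bar> * Lp_norm q T u"
  proof (cases "c = 0")
    case True
    then show ?thesis using main[OF u, of c] Lp_norm_nonneg[OF q \<open>0 < T\<close> 1] by simp
  next
    case False
    then have "Lp_norm q T u \<le> \<bar>inverse c\<bar> * Lp_norm q T (\<lambda>t. c *\<^sub>R u t)"
      using main[OF 1, of "inverse c"] by simp
    then have "\<bar>c\<bar> * Lp_norm q T u \<le> Lp_norm q T (\<lambda>t. c *\<^sub>R u t)"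
      using False by (simp add: field_simps abs_inverse)
    then show ?thesis using main[OF u, of c] by simp
  qed
qed

text \<open>Minkowski's inequality by convexity: if \<open>\<alpha>\<close> and
  \<open>\<beta>\<close> exceed the two norms, then \<open>u + v\<close> is
  \<open>\<alpha> + \<beta>\<close> times a convex combination of \<open>u / \<alpha>\<close> and
  \<open>v / \<beta>\<close>, whose powers integrate to at most 1. Convexity of the power function
  bounds the integral, and \<open>\<alpha>\<close>, \<open>\<beta>\<close> then decrease to the
  norms.\<close>

lemma Lp_add:
  fixes u v :: "real \<Rightarrow> 'a::euclidean_space"
  assumes q: "1 \<le> q" and T: "0 < T" and u: "u \<in> Lp q T" and v: "v \<in> Lp q T"
  shows "(\<lambda>t. u t + v t) \<in> Lp q T" and "Lp_norm q T (\<lambda>t. u t + v t) \<le> Lp_norm q T u + Lp_norm q T v"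
proof -
  let ?M = "lebesgue_on {0..T}"
  note [measurable] = Lp_measurable[OF u] Lp_measurable[OF v]
  have "(\<lambda>t. u t + v t) \<in> Lp q T \<and> Lp_norm q T (\<lambda>t. u t + v t) \<le> Lp_norm q T u + Lp_norm q T v"
  proof (cases rule: ereal_ge_1_cases[OF q])
    case 1
    have "AE t in ?M. norm (u t) \<le> Lp_norm \<infinity> T u" "AE t in ?M. norm (v t) \<le> Lp_norm \<infinity> T v"
      using Lp_norm_infinity_le(1) u v 1 T by blast+
    then have *: "AE t in ?M. norm (u t + v t) \<le> Lp_norm \<infinity> T u + Lp_norm \<infinity> T v"
      by eventually_elim (metis add_mono norm_triangle_ineq order_trans)
    then have "(\<lambda>t. u t + v t) \<in> Lp \<infinity> T" unfolding Lp_infinity_iff by auto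
    then show ?thesis using * Lp_norm_infinity_le(1) T 1 by blast
  next
    case (2 r)
    have iu: "integrable ?M (\<lambda>t. norm (u t) powr r)" and iv: "integrable ?M (\<lambda>t. norm (v t) powr r)"
      using u v 2 by (auto simp: Lp_finite_iff)
    have pw: "norm (u t + v t) powr r \<le> (\<alpha> + \<beta>) powr r * 
       (\<alpha> / (\<alpha> + \<beta>) / \<alpha> powr r * norm (u t) powr r + \<beta> / (\<alpha> + \<beta>) / \<beta> powr r * norm (v t) powr r)"
      if \<alpha>: "0 < \<alpha>" and \<beta>: "0 < \<beta>" for t \<alpha> \<beta>
    proof -
      let ?s = "\<beta> / (\<alpha> + \<beta>)"
      have s: "1 - ?s = \<alpha> / (\<alpha> + \<beta>)" using \<alpha> \<beta> by (simp add: field_simps)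
      have "norm (u t + v t) powr r \<le> (norm (u t) + norm (v t)) powr r"
        using 2 by (intro powr_mono2 norm_triangle_ineq) auto
      also have "norm (u t) + norm (v t) = (\<alpha> + \<beta>) * ((1 - ?s) * (norm (u t) / \<alpha>) + ?s * (norm (v t) / \<beta>))"
      proof -
        have "\<alpha> / (\<alpha> + \<beta>) * (norm (u t) / \<alpha>) = norm (u t) / (\<alpha> + \<beta>)"
          "\<beta> / (\<alpha> + \<beta>) * (norm (v t) / \<beta>) = norm (v t) / (\<alpha> + \<beta>)" using \<alpha> \<beta> by auto
        then show ?thesis
          unfolding s using \<alpha> \<beta> by (simp add: add_divide_distrib[symmetric])
      qed
      also have "\<dots> powr r = (\<alpha> + \<beta>) powr r * ((1 - ?s) * (norm (u t) / \<alpha>) + ?s * (norm (v t) / \<beta>)) powr r"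
        by (rule powr_mult)
      also have "((1 - ?s) * (norm (u t) / \<alpha>) + ?s * (norm (v t) / \<beta>)) powr r \<le>
          (1 - ?s) * (norm (u t) / \<alpha>) powr r + ?s * (norm (v t) / \<beta>) powr r"
        using \<alpha> \<beta> 2 by (intro powr_convex_comb) auto
      finally show ?thesis unfolding s using \<alpha> \<beta> by (simp add: powr_divide mult_left_mono)
    qed
    have "integrable ?M (\<lambda>t. norm (u t + v t) powr r)"
      by (rule Bochner_Integration.integrable_bound[OF _ _ AE_I2, 
          of _ "\<lambda>t. (1 + 1) powr r * (1 / (1 + 1) / 1 powr r * norm (u t) powr r + 1 / (1 + 1) / 1 powr r * norm (v t) powr r)"])
        (use iu iv pw[of 1 1] in \<open>auto simp del: one_add_one intro: order_trans[OF _ abs_ge_self]\<close>)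
    then have uv: "(\<lambda>t. u t + v t) \<in> Lp q T" unfolding 2 Lp_finite_iff by simp
    \<comment> \<open>Strict bounds keep \<open>\<alpha>\<close> and \<open>\<beta>\<close> positive
      even when a norm is zero, so dividing by them is harmless.\<close>
    have le: "Lp_norm q T (\<lambda>t. u t + v t) \<le> \<alpha> + \<beta>" 
      if \<alpha>: "Lp_norm q T u < \<alpha>" and \<beta>: "Lp_norm q T v < \<beta>" for \<alpha> \<beta>
    proof -
      have pos: "0 < \<alpha>" "0 < \<beta>" 
        using Lp_norm_nonneg[OF q T u] Lp_norm_nonneg[OF q T v] \<alpha> \<beta> by auto
      have "(LINT t|?M. norm (u t) powr r) \<le> \<alpha> powr r" "(LINT t|?M. norm (v t) powr r) \<le> \<beta> powr r"
        using \<alpha> \<beta> pos 2 by (auto simp flip: Lp_norm_finite_le)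
      then have i: "1 / \<alpha> powr r * (LINT t|?M. norm (u t) powr r) \<le> 1" "1 / \<beta> powr r * (LINT t|?M. norm (v t) powr r) \<le> 1"
        using pos by (auto simp: field_simps)
      have "(LINT t|?M. norm (u t + v t) powr r) \<le> (LINT t|?M. (\<alpha> + \<beta>) powr r * 
        (\<alpha> / (\<alpha> + \<beta>) / \<alpha> powr r * norm (u t) powr r + \<beta> / (\<alpha> + \<beta>) / \<beta> powr r * norm (v t) powr r))"
        using uv iu iv pw[OF pos] 2 by (intro Bochner_Integration.integral_mono) (auto simp: Lp_finite_iff)
      also have "\<dots> = (\<alpha> + \<beta>) powr r * (\<alpha> / (\<alpha> + \<beta>) * (1 / \<alpha> powr r * (LINT t|?M. norm (u t) powr r)) + 
          \<beta> / (\<alpha> + \<beta>) * (1 / \<beta> powr r * (LINT t|?M. norm (v t) powr r)))"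
        using iu iv by simp
      also have "\<dots> \<le> (\<alpha> + \<beta>) powr r * (\<alpha> / (\<alpha> + \<beta>) * 1 + \<beta> / (\<alpha> + \<beta>) * 1)"
        using pos i by (intro mult_left_mono add_mono) auto
      also have "\<dots> = (\<alpha> + \<beta>) powr r" using pos by (simp add: add_divide_distrib[symmetric])
      finally show ?thesis using pos 2 by (simp add: Lp_norm_finite_le)
    qed
    have "Lp_norm q T (\<lambda>t. u t + v t) \<le> Lp_norm q T u + Lp_norm q T v"
    proof (rule field_le_epsilon)
      fix e :: real assume "0 < e"
      then show "Lp_norm q T (\<lambda>t. u t + v t) \<le> Lp_norm q T u + Lp_norm q T v + e"
        using le[of "Lp_norm q T u + e/2" "Lp_norm q T v + e/2"] by simp
    qed
    then show ?thesis using uv by blast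
  qed
  then show "(\<lambda>t. u t + v t) \<in> Lp q T" "Lp_norm q T (\<lambda>t. u t + v t) \<le> Lp_norm q T u + Lp_norm q T v"
    by auto
qed

text \<open>For finite exponents the elementary bound \<open>x \<le> 1 + x powr r\<close> is scaled
  by a number \<open>\<alpha>\<close> above the norm; letting \<open>\<alpha>\<close> tend to the
  norm leaves the factor \<open>1 + T\<close>, the same for all exponents.\<close>

lemma Lp_imp_integrable:
  fixes u :: "real \<Rightarrow> 'a::euclidean_space"
  assumes q: "1 \<le> q" and T: "0 < T" and u: "u \<in> Lp q T"
  shows "integrable (lebesgue_on {0..T}) u"
    and "(LINT t|lebesgue_on {0..T}. norm (u t)) \<le> (1 + T) * Lp_norm q T u"
proof -
  let ?M = "lebesgue_on {0..T}"
  note [measurable] = Lp_measurable[OF u]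
  have vol: "measure ?M (space ?M) = T" "emeasure ?M (space ?M) < \<infinity>" 
    using T by (simp_all add: measure_restrict_space emeasure_restrict_space)
  interpret finite_measure ?M by standard (use vol in auto)
  have "integrable ?M u \<and> (LINT t|?M. norm (u t)) \<le> (1 + T) * Lp_norm q T u"
  proof (cases rule: ereal_ge_1_cases[OF q])
    case 1
    have ae: "AE t in ?M. norm (u t) \<le> Lp_norm \<infinity> T u"
      using Lp_norm_infinity_le(1) u 1 T by blast
    then have i: "integrable ?M u" by (intro integrable_const_bound) auto
    have "(LINT t|?M. norm (u t)) \<le> (LINT t|?M. Lp_norm \<infinity> T u)"
      using i ae by (intro integral_mono_AE) auto
    also have "\<dots> = T * Lp_norm \<infinity> T u" using vol by simp
    also have "\<dots> \<le> (1 + T) * Lp_norm \<infinity> T u" 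
      using Lp_norm_nonneg[OF q T u] 1 by (intro mult_right_mono) auto
    finally show ?thesis using i 1 by simp
  next
    case (2 r)
    have iu: "integrable ?M (\<lambda>t. norm (u t) powr r)" using u 2 by (auto simp: Lp_finite_iff)
    have pw: "norm (u t) \<le> \<alpha> * (1 + 1 / \<alpha> powr r * norm (u t) powr r)" if \<alpha>: "0 < \<alpha>" for t \<alpha>
    proof -
      have "norm (u t) / \<alpha> \<le> 1 + (norm (u t) / \<alpha>) powr r"
      proof (cases "norm (u t) / \<alpha> \<le> 1")
        case False
        then have "(norm (u t) / \<alpha>) powr 1 \<le> (norm (u t) / \<alpha>) powr r" using 2 by (intro powr_mono) auto
        then show ?thesis using False \<alpha> by simp
      qed (simp add: add_increasing2)
      then show ?thesis using \<alpha> by (simp add: powr_divide pos_divide_le_eq mult.commute)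
    qed
    have i: "integrable ?M u"
      by (rule Bochner_Integration.integrable_bound[OF _ _ AE_I2, 
          of _ "\<lambda>t. 1 * (1 + 1 / 1 powr r * norm (u t) powr r)"])
        (use iu pw[of 1] in \<open>auto intro: order_trans[OF _ abs_ge_self]\<close>)
    have le: "(LINT t|?M. norm (u t)) \<le> (1 + T) * \<alpha>" if \<alpha>: "Lp_norm q T u < \<alpha>" for \<alpha>
    proof -
      have pos: "0 < \<alpha>" using Lp_norm_nonneg[OF q T u] \<alpha> by auto
      have "(LINT t|?M. norm (u t) powr r) \<le> \<alpha> powr r" 
        using \<alpha> pos 2 by (auto simp flip: Lp_norm_finite_le)
      then have *: "1 / \<alpha> powr r * (LINT t|?M. norm (u t) powr r) \<le> 1" using pos by (auto simp: field_simps)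
      have "(LINT t|?M. norm (u t)) \<le> (LINT t|?M. \<alpha> * (1 + 1 / \<alpha> powr r * norm (u t) powr r))"
        using i iu pw[OF pos] by (intro Bochner_Integration.integral_mono) auto
      also have "\<dots> = \<alpha> * (T + 1 / \<alpha> powr r * (LINT t|?M. norm (u t) powr r))"
        using iu vol by simp
      also have "\<dots> \<le> \<alpha> * (T + 1)" using * pos by (intro mult_left_mono) auto
      finally show ?thesis by (simp add: algebra_simps)
    qed
    have "(LINT t|?M. norm (u t)) \<le> (1 + T) * Lp_norm q T u"
    proof (rule field_le_epsilon)
      fix e :: real assume "0 < e"
      then show "(LINT t|?M. norm (u t)) \<le> (1 + T) * Lp_norm q T u + e"
        using le[of "Lp_norm q T u + e / (1 + T)"] T by (simp add: distrib_left)
    qed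
    then show ?thesis using i by blast
  qed
  then show "integrable ?M u" "(LINT t|?M. norm (u t)) \<le> (1 + T) * Lp_norm q T u" by auto
qed

lemma Lp_norm_eq_0_imp_AE:
  fixes u :: "real \<Rightarrow> 'a::euclidean_space"
  assumes "1 \<le> q" "0 < T" "u \<in> Lp q T" "Lp_norm q T u = 0"
  shows "AE t in lebesgue_on {0..T}. u t = 0"
proof -
  have i: "integrable (lebesgue_on {0..T}) u" "(LINT t|lebesgue_on {0..T}. norm (u t)) \<le> 0"
    using Lp_imp_integrable[OF assms(1-3)] assms(4) by auto
  then have "(LINT t|lebesgue_on {0..T}. norm (u t)) = 0"
    by (intro antisym) auto
  then show ?thesis
    using i(1) by (subst (asm) integral_nonneg_eq_0_iff_AE) auto
qed

section \<open>Relative interiors of increasing unions\<close>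

text \<open>A finite affine basis of the union lies in a single member, so the affine hulls agree
  from some index \<open>n0\<close> on. The segment from a relative interior point \<open>e\<close>
  of \<open>E n0\<close> through \<open>x\<close> can be prolonged to a point \<open>y\<close> of
  the union. Once a member also contains \<open>y\<close>, the point \<open>x\<close> between
  \<open>e\<close> and \<open>y\<close> is in its relative interior.\<close>

lemma rel_interior_increasing_union:
  fixes E :: "nat \<Rightarrow> 'a::euclidean_space set"
  assumes convex: "\<And>n. convex (E n)" and mono: "\<And>m n. m \<le> n \<Longrightarrow> E m \<subseteq> E n"
    and x: "x \<in> rel_interior (\<Union>n. E n)"
  obtains n where "x \<in> rel_interior (E n)" "affine hull E n = affine hull (\<Union>n. E n)"
proof -
  let ?R = "\<Union>n. E n"
  obtain S where S: "\<not> affine_dependent S" "S \<subseteq> ?R" "affine hull ?R = affine hull S"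
    using affine_basis_exists by blast
  have ex: "\<exists>n. F \<subseteq> E n" if "finite F" "F \<subseteq> ?R" for F
    using that
  proof (induction F rule: finite_induct)
    case (insert a F)
    then obtain m n where "F \<subseteq> E m" "a \<in> E n" by auto
    then have "insert a F \<subseteq> E (max m n)" using mono[of m "max m n"] mono[of n "max m n"] by auto
    then show ?case by blast
  qed simp
  then obtain n0 where n0: "S \<subseteq> E n0" using ex[OF aff_independent_finite[OF S(1)] S(2)] by blast
  have hull: "affine hull E n = affine hull ?R" if "n0 \<le> n" for n
  proof
    show "affine hull E n \<subseteq> affine hull ?R" by (rule hull_mono) blast
    show "affine hull ?R \<subseteq> affine hull E n"
      unfolding S(3) using n0 mono[OF that] by (intro hull_mono) blast
  qed
  have "?R \<noteq> {}" using x rel_interior_subset by blast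
  then have "E n0 \<noteq> {}" using hull[of n0] by force
  then obtain e where e: "e \<in> rel_interior (E n0)" using rel_interior_eq_empty[OF convex] by blast
  have cR: "convex ?R"
    unfolding convex_def
  proof (intro ballI allI impI)
    fix a b and u v :: real assume *: "a \<in> ?R" "b \<in> ?R" "0 \<le> u" "0 \<le> v" "u + v = 1"
    then obtain n where "{a, b} \<subseteq> E n" using ex[of "{a, b}"] by auto
    then have "u *\<^sub>R a + v *\<^sub>R b \<in> E n" using * by (intro convexD[OF convex]) auto
    then show "u *\<^sub>R a + v *\<^sub>R b \<in> ?R" by blast
  qed
  have "e \<in> affine hull ?R" using subsetD[OF rel_interior_subset e] by (intro hull_inc) blast
  from convex_rel_interior_if2[OF cR x, rule_format, OF this]
  obtain m where m: "1 < m" "(1 - m) *\<^sub>R e + m *\<^sub>R x \<in> ?R" by (elim exE conjE)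
  define y where "y = (1 - m) *\<^sub>R e + m *\<^sub>R x"
  obtain n1 where n1: "y \<in> E n1" using m by (auto simp: y_def)
  define n where "n = max n0 n1"
  have n: "n0 \<le> n" "n1 \<le> n" by (auto simp: n_def)
  have "e \<in> rel_interior (E n)"
    using e subset_rel_interior[OF mono[OF n(1)]] hull n(1) by auto
  then have "y - (1 - 1 / m) *\<^sub>R (y - e) \<in> rel_interior (E n)"
    using m n1 mono[OF n(2)] by (intro rel_interior_convex_shrink convex) auto
  moreover have "y - (1 - 1 / m) *\<^sub>R (y - e) = x"
  proof -
    have "y - (1 - 1 / m) *\<^sub>R (y - e) = (1 / m) *\<^sub>R y + (1 - 1 / m) *\<^sub>R e"
      by (simp add: algebra_simps)
    also have "\<dots> = ((1 - m) / m + (1 - 1 / m)) *\<^sub>R e + x"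
    proof -
      have "(1 / m) *\<^sub>R y = ((1 - m) / m) *\<^sub>R e + x" using m(1) by (simp add: y_def scaleR_add_right)
      then show ?thesis by (simp only: scaleR_add_left ac_simps)
    qed
    also have "(1 - m) / m + (1 - 1 / m) = 0" using m(1) by (simp add: field_simps)
    finally show ?thesis by simp
  qed
  ultimately show thesis using that hull[OF n(1)] by blast
qed

section \<open>Lipschitz continuity of the cost along segments\<close>

text \<open>Young's inequality with crude constants: comparing \<open>a\<close> with
  \<open>b powr (r - 1)\<close> shows that one of the two summands alone dominates the
  product.\<close>

lemma mult_le_powr_add_powr:
  fixes a b r :: real
  assumes "1 < r" "0 \<le> a" "0 \<le> b"
  shows "a * b \<le> a powr (r / (r - 1)) + b powr r"
proof (cases "a \<le> b powr (r - 1)")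
  case True
  then have "a * b \<le> b powr (r - 1) * b powr 1" using assms by (intro mult_mono) auto
  also have "\<dots> = b powr (r - 1 + 1)" by (rule powr_add[symmetric])
  also have "\<dots> = b powr r" by simp
  finally show ?thesis by (simp add: add_increasing)
next
  case False
  then have "(b powr (r - 1)) powr (1 / (r - 1)) \<le> a powr (1 / (r - 1))"
    using assms by (intro powr_mono2) auto
  then have "b \<le> a powr (1 / (r - 1))" using assms by (simp add: powr_powr)
  then have "a * b \<le> a powr 1 * a powr (1 / (r - 1))" using assms by (intro mult_mono) auto
  also have "\<dots> = a powr (1 + 1 / (r - 1))" by (rule powr_add[symmetric])
  also have "1 + 1 / (r - 1) = r / (r - 1)" using assms by (simp add: field_simps)
  finally show ?thesis by (simp add: add_increasing2)
qed

lemma conj_exponent_ereal: "1 < r \<Longrightarrow> conj_exponent (ereal r) = ereal (r / (r - 1))"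
  by (simp add: conj_exponent_def one_ereal_def field_simps)

lemma conj_exponent_1: "conj_exponent 1 = \<infinity>"
proof -
  have "1 - 1 / 1 = (0::ereal)" by simp
  then show ?thesis by (simp only: conj_exponent_def) (simp add: divide_ereal_def)
qed

lemma continuous_bounded_on_cballs:
  fixes g :: "'a::euclidean_space \<Rightarrow> 'b::euclidean_space \<Rightarrow> real \<Rightarrow> 'c::real_normed_vector"
  assumes "continuous_on (UNIV \<times> UNIV \<times> {0..T}) (\<lambda>(x, u, t). g x u t)"
  shows "\<exists>B\<ge>0. \<forall>t\<in>{0..T}. \<forall>x u. norm x \<le> R \<longrightarrow> norm u \<le> M \<longrightarrow> norm (g x u t) \<le> B"
proof -
  let ?S = "cball 0 R \<times> cball 0 M \<times> {0..T}"
  have "compact ((\<lambda>(x, u, t). g x u t) ` ?S)"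
    by (intro compact_continuous_image compact_Times continuous_on_subset[OF assms]) auto
  then have "bounded ((\<lambda>(x, u, t). g x u t) ` ?S)" by (rule compact_imp_bounded)
  then obtain B where B: "\<forall>z\<in>(\<lambda>(x, u, t). g x u t) ` ?S. norm z \<le> B"
    unfolding bounded_iff by (elim exE)
  show ?thesis
  proof (intro exI[of _ "max 0 B"] conjI ballI allI impI)
    fix t and x :: 'a and u :: 'b assume "t \<in> {0..T}" "norm x \<le> R" "norm u \<le> M"
    then have "norm ((\<lambda>(x, u, t). g x u t) (x, u, t)) \<le> B" by (intro bspec[OF B] imageI) auto
    then show "norm (g x u t) \<le> max 0 B" by simp
  qed simp
qed

lemma GDERIV_lipschitz:
  fixes f :: "'a::euclidean_space \<Rightarrow> real"
  assumes "\<And>x. GDERIV f x :> D x" and "\<And>x. norm x \<le> R \<Longrightarrow> norm (D x) \<le> B"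
    and "norm x \<le> R" "norm y \<le> R"
  shows "\<bar>f x - f y\<bar> \<le> B * norm (x - y)"
proof -
  have "norm (f x - f y) \<le> B * norm (x - y)"
  proof (rule differentiable_bound[of "cball 0 R"])
    fix z :: 'a assume z: "z \<in> cball 0 R"
    show "(f has_derivative (\<lambda>h. h \<bullet> D z)) (at z within cball 0 R)"
      using assms(1)[of z] unfolding gderiv_def by (rule has_derivative_at_withinI)
    show "onorm (\<lambda>h. h \<bullet> D z) \<le> B"
    proof (rule onorm_bound)
      have "norm (D z) \<le> B" using assms(2) z by simp
      then show "0 \<le> B" using norm_ge_zero order_trans by blast
      fix h :: 'a
      have "norm (h \<bullet> D z) \<le> norm h * norm (D z)" using Cauchy_Schwarz_ineq2 by simp
      also have "\<dots> \<le> norm h * B" using \<open>norm (D z) \<le> B\<close> by (intro mult_left_mono) auto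
      finally show "norm (h \<bullet> D z) \<le> B * norm h" by (simp add: mult.commute)
    qed
  qed (use assms in auto)
  then show ?thesis by simp
qed

locale integrand =
  fixes q :: ereal and T :: real
    and \<theta> :: "'x::euclidean_space \<Rightarrow> 'u::euclidean_space \<Rightarrow> real \<Rightarrow> real"
    and \<theta>\<^sub>x :: "'x \<Rightarrow> 'u \<Rightarrow> real \<Rightarrow> 'x"
    and \<theta>\<^sub>u :: "'x \<Rightarrow> 'u \<Rightarrow> real \<Rightarrow> 'u"
  assumes q: "1 \<le> q" and T: "0 < T"
    and cont: "continuous_on (UNIV \<times> UNIV \<times> {0..T}) (\<lambda>(x, u, t). \<theta> x u t)"
    and grad_x: "\<And>x u t. t \<in> {0..T} \<Longrightarrow> GDERIV (\<lambda>y. \<theta> y u t) x :> \<theta>\<^sub>x x u t"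
    and grad_u: "\<And>x u t. t \<in> {0..T} \<Longrightarrow> GDERIV (\<lambda>v. \<theta> x v t) u :> \<theta>\<^sub>u x u t"
    and cont_x: "continuous_on (UNIV \<times> UNIV \<times> {0..T}) (\<lambda>(x, u, t). \<theta>\<^sub>x x u t)"
    and cont_u: "continuous_on (UNIV \<times> UNIV \<times> {0..T}) (\<lambda>(x, u, t). \<theta>\<^sub>u x u t)"
    and growth: "q = \<infinity> \<or>
      growth_condition T (real_of_ereal q) 1 \<theta> \<and>
      growth_condition T (real_of_ereal q) 1 \<theta>\<^sub>x \<and>
      growth_condition T (real_of_ereal q - 1) (conj_exponent q) \<theta>\<^sub>u"
begin

abbreviation "M\<^sub>T \<equiv> lebesgue_on {0..T}"

lemma AE_interval: "AE t in M\<^sub>T. t \<in> {0..T}"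
  by (rule AE_I2) simp

sublocale finite_measure M\<^sub>T
  by standard (use T in \<open>simp add: emeasure_restrict_space\<close>)

text \<open>
  State and control are changed one after the other, so that only the partial derivatives are needed.
\<close>

lemma increment_bound:
  assumes t: "t \<in> {0..T}" and a: "0 \<le> a" "a \<le> 1" and x: "norm x \<le> R" "norm y \<le> R"
    and u: "norm u + norm v \<le> s"
    and B: "\<And>\<xi> \<zeta>. norm \<xi> \<le> R \<Longrightarrow> norm \<zeta> \<le> s \<Longrightarrow> norm (\<theta>\<^sub>x \<xi> \<zeta> t) \<le> B1 \<and> norm (\<theta>\<^sub>u \<xi> \<zeta> t) \<le> B2"
  shows "\<bar>\<theta> ((1 - a) *\<^sub>R x + a *\<^sub>R y) ((1 - a) *\<^sub>R u + a *\<^sub>R v) t - \<theta> x u t\<bar> \<le> a * (2 * R * B1 + s * B2)"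
proof -
  let ?w = "(1 - a) *\<^sub>R x + a *\<^sub>R y" and ?z = "(1 - a) *\<^sub>R u + a *\<^sub>R v"
  have "?w \<in> cball 0 R" using a x by (intro convexD_alt[of "cball 0 R" x y a]) auto
  then have w: "norm ?w \<le> R" by simp
  have us: "norm u \<le> s" "norm v \<le> s" using u by (auto intro: order_trans[rotated])
  then have "?z \<in> cball 0 s" using a by (intro convexD_alt[of "cball 0 s" u v a]) auto
  then have z: "norm ?z \<le> s" by simp
  have B1: "0 \<le> B1" "0 \<le> B2" using B[OF x(1) us(1)] norm_ge_zero order_trans by blast+
  have "\<bar>\<theta> ?w ?z t - \<theta> x ?z t\<bar> \<le> B1 * norm (?w - x)"
    using B z by (intro GDERIV_lipschitz[of "\<lambda>y. \<theta> y ?z t" "\<lambda>y. \<theta>\<^sub>x y ?z t" R] grad_x t w x) blast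
  also have "norm (?w - x) = a * norm (y - x)"
  proof -
    have "?w - x = a *\<^sub>R (y - x)" by (simp add: algebra_simps)
    then show ?thesis using a by simp
  qed
  also have "B1 * (a * norm (y - x)) \<le> B1 * (a * (2 * R))"
    using B1 a x norm_triangle_ineq4[of y x] by (intro mult_left_mono) auto
  finally have 1: "\<bar>\<theta> ?w ?z t - \<theta> x ?z t\<bar> \<le> B1 * (a * (2 * R))" .
  have "\<bar>\<theta> x ?z t - \<theta> x u t\<bar> \<le> B2 * norm (?z - u)"
    using B x by (intro GDERIV_lipschitz[of "\<lambda>v. \<theta> x v t" "\<lambda>v. \<theta>\<^sub>u x v t" s] grad_u t z us) blast
  also have "norm (?z - u) = a * norm (v - u)"
  proof -
    have "?z - u = a *\<^sub>R (v - u)" by (simp add: algebra_simps)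
    then show ?thesis using a by simp
  qed
  also have "B2 * (a * norm (v - u)) \<le> B2 * (a * s)"
    using B1 a u norm_triangle_ineq4[of v u] by (intro mult_left_mono) auto
  finally have 2: "\<bar>\<theta> x ?z t - \<theta> x u t\<bar> \<le> B2 * (a * s)" .
  from 1 2 have "\<bar>\<theta> ?w ?z t - \<theta> x u t\<bar> \<le> B1 * (a * (2 * R)) + B2 * (a * s)" by linarith
  then show ?thesis by (simp add: algebra_simps)
qed

lemma Lp_1_integrable: "w \<in> Lp 1 T \<Longrightarrow> integrable M\<^sub>T (w :: real \<Rightarrow> real)"
  by (rule Lp_imp_integrable) (use T in auto)

text \<open>Here \<open>s\<close> stands for the sum of the norms of two controls, and
  \<open>2 * R * B1 + s t * B2\<close> is the increment per unit of the segment parameter found in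
  \<open>increment_bound\<close>. For finite \<open>q = r\<close> the growth orders bound it by a
  multiple of \<open>s t powr r\<close> plus a fixed integrable function, so its integral is
  controlled by \<open>M powr r\<close>. For infinite \<open>q\<close> the gradients are bounded on
  a compact set.\<close>

lemma growth_majorant:
  assumes "0 < R" "0 < M"
  shows "\<exists>L\<ge>0. \<forall>s. s \<in> Lp q T \<longrightarrow> (\<forall>t. 0 \<le> s t) \<longrightarrow> Lp_norm q T s \<le> M \<longrightarrow>
    (\<exists>G. integrable M\<^sub>T G \<and> integral\<^sup>L M\<^sub>T G \<le> L \<and> (AE t in M\<^sub>T. \<exists>B1 B2.
      (\<forall>\<xi> \<zeta>. norm \<xi> \<le> R \<longrightarrow> norm \<zeta> \<le> s t \<longrightarrow> norm (\<theta>\<^sub>x \<xi> \<zeta> t) \<le> B1 \<and> norm (\<theta>\<^sub>u \<xi> \<zeta> t) \<le> B2) \<and>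
      2 * R * B1 + s t * B2 \<le> G t))"
proof (cases rule: ereal_ge_1_cases[OF q])
  case 1
  obtain B1 where B1: "0 \<le> B1" "\<forall>t\<in>{0..T}. \<forall>x u. norm x \<le> R \<longrightarrow> norm u \<le> M \<longrightarrow> norm (\<theta>\<^sub>x x u t) \<le> B1"
    using continuous_bounded_on_cballs[OF cont_x, of R M] by blast
  obtain B2 where B2: "0 \<le> B2" "\<forall>t\<in>{0..T}. \<forall>x u. norm x \<le> R \<longrightarrow> norm u \<le> M \<longrightarrow> norm (\<theta>\<^sub>u x u t) \<le> B2"
    using continuous_bounded_on_cballs[OF cont_u, of R M] by blast
  let ?G = "2 * R * B1 + M * B2"
  show ?thesis
  proof (intro exI[of _ "T * ?G"] conjI allI impI)
    show "0 \<le> T * ?G" using T B1 B2 assms by auto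
    fix s :: "real \<Rightarrow> real" assume s: "s \<in> Lp q T" "\<forall>t. 0 \<le> s t" "Lp_norm q T s \<le> M"
    have "AE t in M\<^sub>T. norm (s t) \<le> M" using s Lp_norm_infinity_le(1) 1 T by blast
    then have "AE t in M\<^sub>T. \<exists>B1 B2.
      (\<forall>\<xi> \<zeta>. norm \<xi> \<le> R \<longrightarrow> norm \<zeta> \<le> s t \<longrightarrow> norm (\<theta>\<^sub>x \<xi> \<zeta> t) \<le> B1 \<and> norm (\<theta>\<^sub>u \<xi> \<zeta> t) \<le> B2) \<and>
      2 * R * B1 + s t * B2 \<le> ?G"
      using AE_interval
    proof eventually_elim
      case (elim t)
      then have "s t * B2 \<le> M * B2" using B2 by (intro mult_right_mono) auto
      then show ?case using elim B1 B2 by (intro exI[of _ B1] exI[of _ B2]) (auto dest: order_trans)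
    qed
    then show "\<exists>G. integrable M\<^sub>T G \<and> integral\<^sup>L M\<^sub>T G \<le> T * ?G \<and> (AE t in M\<^sub>T. \<exists>B1 B2.
      (\<forall>\<xi> \<zeta>. norm \<xi> \<le> R \<longrightarrow> norm \<zeta> \<le> s t \<longrightarrow> norm (\<theta>\<^sub>x \<xi> \<zeta> t) \<le> B1 \<and> norm (\<theta>\<^sub>u \<xi> \<zeta> t) \<le> B2) \<and>
      2 * R * B1 + s t * B2 \<le> G t)"
      using T by (intro exI[of _ "\<lambda>t. ?G"]) (auto simp: measure_restrict_space)
  qed
next
  case (2 r)
  with growth have gx: "growth_condition T r 1 \<theta>\<^sub>x" and gu: "growth_condition T (r - 1) (conj_exponent q) \<theta>\<^sub>u"
    by auto
  from gx[unfolded growth_condition_def, rule_format, OF assms(1)] obtain C1 \<omega>1 where C1: "0 < C1" "\<omega>1 \<in> Lp 1 T" "AE t in M\<^sub>T. 0 \<le> \<omega>1 t"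
    and bx: "AE t in M\<^sub>T. \<forall>x u. norm x \<le> R \<longrightarrow> norm (\<theta>\<^sub>x x u t) \<le> C1 * (if r = 0 then 1 else norm u powr r) + \<omega>1 t"
    by (elim exE conjE) (rule that)
  from gu[unfolded growth_condition_def, rule_format, OF assms(1)] obtain C2 \<omega>2 where C2: "0 < C2" "\<omega>2 \<in> Lp (conj_exponent q) T" "AE t in M\<^sub>T. 0 \<le> \<omega>2 t"
    and bu: "AE t in M\<^sub>T. \<forall>x u. norm x \<le> R \<longrightarrow> 
      norm (\<theta>\<^sub>u x u t) \<le> C2 * (if r - 1 = 0 then 1 else norm u powr (r - 1)) + \<omega>2 t"
    by (elim exE conjE) (rule that)
  \<comment> \<open>The factor \<open>s\<close> lifts the order \<open>r - 1\<close> to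
    \<open>r\<close>. The product of \<open>s\<close> and \<open>\<omega>2\<close> is split by
    Young's inequality, which fits because \<open>\<omega>2\<close> has the conjugate exponent. For
    \<open>r = 1\<close> the function \<open>\<omega>2\<close> is essentially bounded and enters the
    constant instead.\<close>
  have "\<exists>C h. 0 \<le> C \<and> integrable M\<^sub>T h \<and> (AE t in M\<^sub>T. 0 \<le> h t \<and>
      (\<forall>s\<ge>0. s * (C2 * (if r - 1 = 0 then 1 else s powr (r - 1)) + \<omega>2 t) \<le> C * s powr r + h t))"
  proof (cases "r = 1")
    case True
    then have "\<omega>2 \<in> Lp \<infinity> T" using C2(2) 2 by (simp add: conj_exponent_1 flip: one_ereal_def)
    then obtain W where W: "AE t in M\<^sub>T. norm (\<omega>2 t) \<le> W" by (auto simp: Lp_infinity_iff)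
    have "AE t in M\<^sub>T. 0 \<le> (0::real) \<and> 
        (\<forall>s\<ge>0. s * (C2 * (if r - 1 = 0 then 1 else s powr (r - 1)) + \<omega>2 t) \<le> (C2 + \<bar>W\<bar>) * s powr r + 0)"
      using W
    proof eventually_elim
      case (elim t)
      have "s * (C2 + \<omega>2 t) \<le> s * (C2 + \<bar>W\<bar>)" if "0 \<le> s" for s
        using that elim by (intro mult_left_mono) auto
      then show ?case using True by (auto simp: mult.commute)
    qed
    then show ?thesis using C2(1) by (intro exI[of _ "C2 + \<bar>W\<bar>"] exI[of _ "\<lambda>t. 0"]) auto
  next
    case False
    then have r: "1 < r" using 2 by simp
    have h: "integrable M\<^sub>T (\<lambda>t. norm (\<omega>2 t) powr (r / (r - 1)))"
      using C2(2) 2 r by (simp add: conj_exponent_ereal Lp_finite_iff)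
    have "s * (C2 * (if r - 1 = 0 then 1 else s powr (r - 1)) + \<omega>2 t) \<le> 
        (C2 + 1) * s powr r + norm (\<omega>2 t) powr (r / (r - 1))" if "0 \<le> s" for s t
    proof -
      have "s * s powr (r - 1) = s powr 1 * s powr (r - 1)" using that by simp
      also have "\<dots> = s powr (1 + (r - 1))" by (rule powr_add[symmetric])
      also have "\<dots> = s powr r" by simp
      finally have *: "s * s powr (r - 1) = s powr r" .
      have "\<omega>2 t * s \<le> norm (\<omega>2 t) * s" using that by (intro mult_right_mono) auto
      also have "\<dots> \<le> norm (\<omega>2 t) powr (r / (r - 1)) + s powr r"
        using that by (intro mult_le_powr_add_powr r) auto
      finally show ?thesis using False * by (simp add: algebra_simps)
    qed
    then show ?thesis using h C2(1) 
      by (intro exI[of _ "C2 + 1"] exI[of _ "\<lambda>t. norm (\<omega>2 t) powr (r / (r - 1))"]) auto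
  qed
  then obtain C3 h where C3: "0 \<le> C3" "integrable M\<^sub>T h" and
    h: "AE t in M\<^sub>T. 0 \<le> h t \<and>
      (\<forall>s\<ge>0. s * (C2 * (if r - 1 = 0 then 1 else s powr (r - 1)) + \<omega>2 t) \<le> C3 * s powr r + h t)" by blast
  have i1: "integrable M\<^sub>T \<omega>1" using C1(2) by (rule Lp_1_integrable)
  let ?C = "2 * R * C1 + C3"
  let ?h = "\<lambda>t. 2 * R * \<omega>1 t + h t"
  have hnn: "AE t in M\<^sub>T. 0 \<le> ?h t" using C1(3) h by eventually_elim (use assms in auto)
  show ?thesis
  proof (intro exI[of _ "?C * M powr r + integral\<^sup>L M\<^sub>T ?h"] conjI allI impI)
    show "0 \<le> ?C * M powr r + integral\<^sup>L M\<^sub>T ?h"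
      using assms C1(1) C3(1) integral_nonneg_AE[OF hnn] by auto
    fix s :: "real \<Rightarrow> real" assume s: "s \<in> Lp q T" "\<forall>t. 0 \<le> s t" "Lp_norm q T s \<le> M"
    have is1: "integrable M\<^sub>T (\<lambda>t. s t powr r)" and le: "(LINT t|M\<^sub>T. s t powr r) \<le> M powr r"
      using s 2 assms by (auto simp: Lp_finite_iff Lp_norm_finite_le)
    let ?G = "\<lambda>t. ?C * s t powr r + ?h t"
    have iG: "integrable M\<^sub>T ?G" using is1 i1 C3(2) by auto
    have "integral\<^sup>L M\<^sub>T ?G = ?C * (LINT t|M\<^sub>T. s t powr r) + integral\<^sup>L M\<^sub>T ?h"
      using is1 i1 C3(2) by simp
    also have "\<dots> \<le> ?C * M powr r + integral\<^sup>L M\<^sub>T ?h"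
      using le assms C1(1) C3(1) by (intro add_right_mono mult_left_mono) auto
    finally have leG: "integral\<^sup>L M\<^sub>T ?G \<le> ?C * M powr r + integral\<^sup>L M\<^sub>T ?h" .
    have "AE t in M\<^sub>T. \<exists>B1 B2.
      (\<forall>\<xi> \<zeta>. norm \<xi> \<le> R \<longrightarrow> norm \<zeta> \<le> s t \<longrightarrow> norm (\<theta>\<^sub>x \<xi> \<zeta> t) \<le> B1 \<and> norm (\<theta>\<^sub>u \<xi> \<zeta> t) \<le> B2) \<and>
      2 * R * B1 + s t * B2 \<le> ?G t"
      using bx bu h
    proof eventually_elim
      case (elim t)
      have st: "0 \<le> s t" using s by simp
      let ?B1 = "C1 * s t powr r + \<omega>1 t"
      let ?B2 = "C2 * (if r - 1 = 0 then 1 else s t powr (r - 1)) + \<omega>2 t"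
      have "norm (\<theta>\<^sub>x \<xi> \<zeta> t) \<le> ?B1 \<and> norm (\<theta>\<^sub>u \<xi> \<zeta> t) \<le> ?B2" if "norm \<xi> \<le> R" "norm \<zeta> \<le> s t" for \<xi> \<zeta>
      proof
        have "norm \<zeta> powr r \<le> s t powr r" "norm \<zeta> powr (r - 1) \<le> s t powr (r - 1)"
          using that 2 by (auto intro!: powr_mono2)
        then have "C1 * norm \<zeta> powr r \<le> C1 * s t powr r" 
          and "C2 * norm \<zeta> powr (r - 1) \<le> C2 * s t powr (r - 1)"
          using C1(1) C2(1) by auto
        then show "norm (\<theta>\<^sub>x \<xi> \<zeta> t) \<le> ?B1" "norm (\<theta>\<^sub>u \<xi> \<zeta> t) \<le> ?B2"
          using elim(1)[rule_format, OF that(1), of \<zeta>] elim(2)[rule_format, OF that(1), of \<zeta>] 2 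
          by (auto split: if_splits)
      qed
      moreover have "s t * ?B2 \<le> C3 * s t powr r + h t" using elim(3) st by blast
      then have "2 * R * ?B1 + s t * ?B2 \<le> ?G t" by (simp add: algebra_simps)
      ultimately show ?case by blast
    qed
    with iG leG show "\<exists>G. integrable M\<^sub>T G \<and> integral\<^sup>L M\<^sub>T G \<le> ?C * M powr r + integral\<^sup>L M\<^sub>T ?h \<and> (AE t in M\<^sub>T. \<exists>B1 B2.
      (\<forall>\<xi> \<zeta>. norm \<xi> \<le> R \<longrightarrow> norm \<zeta> \<le> s t \<longrightarrow> norm (\<theta>\<^sub>x \<xi> \<zeta> t) \<le> B1 \<and> norm (\<theta>\<^sub>u \<xi> \<zeta> t) \<le> B2) \<and>
      2 * R * B1 + s t * B2 \<le> G t)"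
      by (intro exI[of _ ?G] conjI)
  qed
qed

text \<open>Continuity of \<open>\<theta>\<close> is given only for times in \<open>{0..T}\<close>.
  Clamping the time to this interval produces a continuous function on the whole space and changes
  nothing along the trajectory.\<close>

lemma measurable_along:
  assumes x: "x \<in> borel_measurable M\<^sub>T" and u: "u \<in> borel_measurable M\<^sub>T"
  shows "(\<lambda>t. \<theta> (x t) (u t) t) \<in> borel_measurable M\<^sub>T"
proof -
  let ?c = "\<lambda>t. max 0 (min T t)"
  have "continuous_on UNIV (\<lambda>z. (\<lambda>(x, u, t). \<theta> x u t) ((\<lambda>(x, u, t). (x, u, ?c t)) z))"
    by (rule continuous_on_compose2[OF cont])
      (use T in \<open>auto simp: case_prod_beta intro!: continuous_intros\<close>)
  moreover have "(\<lambda>t. (x t, u t, t)) \<in> M\<^sub>T \<rightarrow>\<^sub>M borel"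
    by (intro borel_measurable_Pair x u continuous_imp_measurable_on_sets_lebesgue continuous_on_id) auto
  ultimately have "(\<lambda>t. \<theta> (x t) (u t) (?c t)) \<in> borel_measurable M\<^sub>T"
    using borel_measurable_continuous_on[of "\<lambda>(x, u, t). \<theta> x u (?c t)" "\<lambda>t. (x t, u t, t)" M\<^sub>T] 
    by (simp add: case_prod_beta)
  then show ?thesis by (rule measurable_cong[THEN iffD1, rotated]) auto
qed

lemma integrable_along:
  assumes x: "x \<in> borel_measurable M\<^sub>T" "\<And>t. t \<in> {0..T} \<Longrightarrow> norm (x t) \<le> R" and u: "u \<in> Lp q T"
  shows "integrable M\<^sub>T (\<lambda>t. \<theta> (x t) (u t) t)"
proof -
  \<comment> \<open>The growth condition speaks of positive radii only, and \<open>R\<close> may be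
    zero.\<close>
  have R: "norm (x t) \<le> max R 1" if "t \<in> {0..T}" for t using x(2)[OF that] by simp
  note m[measurable] = measurable_along[OF x(1) Lp_measurable[OF u]]
  show ?thesis
  proof (cases rule: ereal_ge_1_cases[OF q])
    case 1
    let ?U = "Lp_norm q T u"
    obtain B where B: "\<forall>t\<in>{0..T}. \<forall>x u. norm x \<le> max R 1 \<longrightarrow> norm u \<le> ?U \<longrightarrow> norm (\<theta> x u t) \<le> B"
      using continuous_bounded_on_cballs[OF cont, of "max R 1" ?U] by blast
    have "AE t in M\<^sub>T. norm (u t) \<le> ?U" using u Lp_norm_infinity_le(1) 1 T by blast
    then have "AE t in M\<^sub>T. norm (\<theta> (x t) (u t) t) \<le> B"
      using AE_interval by eventually_elim (use B R in blast)
    then show ?thesis by (intro integrable_const_bound[of _ B]) auto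
  next
    case (2 r)
    with growth have g: "growth_condition T r 1 \<theta>" by auto
    have "0 < max R 1" by simp
    from g[unfolded growth_condition_def, rule_format, OF this] obtain C \<omega> where C: "0 < C" "\<omega> \<in> Lp 1 T"
      and b: "AE t in M\<^sub>T. \<forall>x u. norm x \<le> max R 1 \<longrightarrow> norm (\<theta> x u t) \<le> C * (if r = 0 then 1 else norm u powr r) + \<omega> t"
      by (elim exE conjE) (rule that)
    have i: "integrable M\<^sub>T (\<lambda>t. C * norm (u t) powr r + \<omega> t)"
      using u 2 Lp_1_integrable[OF C(2)] by (auto simp: Lp_finite_iff)
    show ?thesis
    proof (rule Bochner_Integration.integrable_bound[OF i m])
      show "AE t in M\<^sub>T. norm (\<theta> (x t) (u t) t) \<le> norm (C * norm (u t) powr r + \<omega> t)"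
        using b AE_interval
      proof eventually_elim
        case (elim t)
        then have "norm (\<theta> (x t) (u t) t) \<le> C * norm (u t) powr r + \<omega> t" using R[of t] 2 by force
        then show ?case by simp
      qed
    qed
  qed
qed

lemma integral_lipschitz_segment:
  assumes "0 < R" "0 < M"
  shows "\<exists>L\<ge>0. \<forall>x y u v a. continuous_on {0..T} x \<longrightarrow> continuous_on {0..T} y \<longrightarrow> 
    (\<forall>t\<in>{0..T}. norm (x t) \<le> R \<and> norm (y t) \<le> R) \<longrightarrow> u \<in> Lp q T \<longrightarrow> v \<in> Lp q T \<longrightarrow>
    Lp_norm q T u \<le> M \<longrightarrow> Lp_norm q T v \<le> M \<longrightarrow> 0 \<le> a \<longrightarrow> a \<le> 1 \<longrightarrow>
    \<bar>(LINT t|M\<^sub>T. \<theta> ((1 - a) *\<^sub>R x t + a *\<^sub>R y t) ((1 - a) *\<^sub>R u t + a *\<^sub>R v t) t) - (LINT t|M\<^sub>T. \<theta> (x t) (u t) t)\<bar> \<le> a * L"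
proof -
  \<comment> \<open>\<open>M + M\<close> bounds the norm of \<open>norm (u t) + norm (v t)\<close>,
    which dominates both controls and everything on the segment between them.\<close>
  have "0 < M + M" using assms by simp
  from growth_majorant[OF assms(1) this] obtain L where L: "0 \<le> L" and
    maj: "\<And>s. s \<in> Lp q T \<Longrightarrow> (\<And>t. 0 \<le> s t) \<Longrightarrow> Lp_norm q T s \<le> M + M \<Longrightarrow>
    (\<exists>G. integrable M\<^sub>T G \<and> integral\<^sup>L M\<^sub>T G \<le> L \<and> (AE t in M\<^sub>T. \<exists>B1 B2.
      (\<forall>\<xi> \<zeta>. norm \<xi> \<le> R \<longrightarrow> norm \<zeta> \<le> s t \<longrightarrow> norm (\<theta>\<^sub>x \<xi> \<zeta> t) \<le> B1 \<and> norm (\<theta>\<^sub>u \<xi> \<zeta> t) \<le> B2) \<and>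
      2 * R * B1 + s t * B2 \<le> G t))"
    by blast
  show ?thesis
  proof (intro exI[of _ L] conjI allI impI L)
    fix x y :: "real \<Rightarrow> 'x" and u v :: "real \<Rightarrow> 'u" and a :: real
    assume x: "continuous_on {0..T} x" "continuous_on {0..T} y" "\<forall>t\<in>{0..T}. norm (x t) \<le> R \<and> norm (y t) \<le> R"
      and u: "u \<in> Lp q T" "v \<in> Lp q T" "Lp_norm q T u \<le> M" "Lp_norm q T v \<le> M" and a: "0 \<le> a" "a \<le> 1"
    let ?w = "\<lambda>t. (1 - a) *\<^sub>R x t + a *\<^sub>R y t" and ?z = "\<lambda>t. (1 - a) *\<^sub>R u t + a *\<^sub>R v t"
    let ?s = "\<lambda>t. norm (u t) + norm (v t)"
    have nu: "(\<lambda>t. norm (u t)) \<in> Lp q T" "(\<lambda>t. norm (v t)) \<in> Lp q T"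
      using u Lp_measurable[OF u(1)] Lp_measurable[OF u(2)] by (auto simp: Lp_def)
    have "Lp_norm q T (\<lambda>t. norm (u t)) = Lp_norm q T u" "Lp_norm q T (\<lambda>t. norm (v t)) = Lp_norm q T v"
      by (auto simp: Lp_norm_def)
    then have s: "?s \<in> Lp q T" "Lp_norm q T ?s \<le> M + M"
      using Lp_add[OF q T nu] u by auto
    from maj[OF s(1) _ s(2)] obtain G where G: "integrable M\<^sub>T G" "integral\<^sup>L M\<^sub>T G \<le> L" "AE t in M\<^sub>T. \<exists>B1 B2.
      (\<forall>\<xi> \<zeta>. norm \<xi> \<le> R \<longrightarrow> norm \<zeta> \<le> ?s t \<longrightarrow> norm (\<theta>\<^sub>x \<xi> \<zeta> t) \<le> B1 \<and> norm (\<theta>\<^sub>u \<xi> \<zeta> t) \<le> B2) \<and>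
      2 * R * B1 + ?s t * B2 \<le> G t" by auto
    have xm: "x \<in> borel_measurable M\<^sub>T" "?w \<in> borel_measurable M\<^sub>T" 
      using x by (auto intro!: continuous_imp_measurable_on_sets_lebesgue continuous_intros)
    have w: "norm (?w t) \<le> R" if "t \<in> {0..T}" for t
      using convexD_alt[of "cball 0 R" "x t" "y t" a] x(3) that a by auto
    have z: "?z \<in> Lp q T" by (intro Lp_add Lp_scaleR q T u)
    have i: "integrable M\<^sub>T (\<lambda>t. \<theta> (?w t) (?z t) t)" "integrable M\<^sub>T (\<lambda>t. \<theta> (x t) (u t) t)"
      using x by (auto intro!: integrable_along[OF _ _ z] integrable_along[OF _ _ u(1)] xm w)
    have "AE t in M\<^sub>T. \<bar>\<theta> (?w t) (?z t) t - \<theta> (x t) (u t) t\<bar> \<le> a * G t"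
      using G(3) AE_interval
    proof eventually_elim
      case (elim t)
      then obtain B1 B2 where B: "\<And>\<xi> \<zeta>. norm \<xi> \<le> R \<Longrightarrow> norm \<zeta> \<le> ?s t \<Longrightarrow> norm (\<theta>\<^sub>x \<xi> \<zeta> t) \<le> B1 \<and> norm (\<theta>\<^sub>u \<xi> \<zeta> t) \<le> B2"
        "2 * R * B1 + ?s t * B2 \<le> G t" by blast
      have "\<bar>\<theta> (?w t) (?z t) t - \<theta> (x t) (u t) t\<bar> \<le> a * (2 * R * B1 + ?s t * B2)"
        using x(3) elim(2) by (intro increment_bound a order_refl B(1)) auto
      also have "\<dots> \<le> a * G t" using a B(2) by (intro mult_left_mono)
      finally show ?case .
    qed
    then have "(LINT t|M\<^sub>T. \<bar>\<theta> (?w t) (?z t) t - \<theta> (x t) (u t) t\<bar>) \<le> (LINT t|M\<^sub>T. a * G t)"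
      using i G(1) by (intro integral_mono_AE) auto
    also have "\<dots> \<le> a * L" using G(2) a by (simp add: mult_left_mono)
    finally show "\<bar>(LINT t|M\<^sub>T. \<theta> (?w t) (?z t) t) - (LINT t|M\<^sub>T. \<theta> (x t) (u t) t)\<bar> \<le> a * L"
      using integral_abs_bound[of M\<^sub>T "\<lambda>t. \<theta> (?w t) (?z t) t - \<theta> (x t) (u t) t"] i by simp
  qed
qed

end

section \<open>Trajectories\<close>

text \<open>\<open>W1p\<close> demands membership in \<open>Lp\<close> of the derivative only. For
  the function itself it follows from boundedness on the compact interval, and the first summand of
  \<open>W1p_norm\<close> can then be estimated.\<close>

lemma continuous_on_imp_Lp:
  fixes x :: "real \<Rightarrow> 'a::euclidean_space"
  assumes q: "1 \<le> q" and T: "0 < T" and x: "continuous_on {0..T} x"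
  shows "x \<in> Lp q T"
proof -
  have m[measurable]: "x \<in> borel_measurable (lebesgue_on {0..T})"
    using x by (rule continuous_imp_measurable_on_sets_lebesgue) auto
  have "bounded (x ` {0..T})" using x by (intro compact_imp_bounded compact_continuous_image) auto
  then obtain B where B: "\<forall>y\<in>x ` {0..T}. norm y \<le> B" unfolding bounded_iff by (elim exE)
  then have ae: "AE t in lebesgue_on {0..T}. norm (x t) \<le> B" by (intro AE_I2) auto
  interpret finite_measure "lebesgue_on {0..T}"
    by standard (use T in \<open>simp add: emeasure_restrict_space\<close>)
  show ?thesis
  proof (cases rule: ereal_ge_1_cases[OF q])
    case 1
    then show ?thesis using ae m by (auto simp: Lp_infinity_iff)
  next
    case (2 r)
    have "AE t in lebesgue_on {0..T}. norm (norm (x t) powr r) \<le> B powr r"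
      using ae by eventually_elim (use 2 in \<open>auto intro: powr_mono2\<close>)
    then have "integrable (lebesgue_on {0..T}) (\<lambda>t. norm (x t) powr r)"
      by (rule integrable_const_bound) simp
    then show ?thesis using 2 by (simp add: Lp_finite_iff)
  qed
qed

lemma Lp_lincomb:
  fixes u v :: "real \<Rightarrow> 'a::euclidean_space"
  assumes "1 \<le> q" "0 < T" "u \<in> Lp q T" "v \<in> Lp q T"
  shows "(\<lambda>t. a *\<^sub>R u t + b *\<^sub>R v t) \<in> Lp q T"
    and "Lp_norm q T (\<lambda>t. a *\<^sub>R u t + b *\<^sub>R v t) \<le> \<bar>a\<bar> * Lp_norm q T u + \<bar>b\<bar> * Lp_norm q T v"
proof -
  note s = Lp_scaleR[OF assms(1,2,3), of a] Lp_scaleR[OF assms(1,2,4), of b]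
  show "(\<lambda>t. a *\<^sub>R u t + b *\<^sub>R v t) \<in> Lp q T"
    by (rule Lp_add(1)[OF assms(1,2) s(1,3)])
  show "Lp_norm q T (\<lambda>t. a *\<^sub>R u t + b *\<^sub>R v t) \<le> \<bar>a\<bar> * Lp_norm q T u + \<bar>b\<bar> * Lp_norm q T v"
    using Lp_add(2)[OF assms(1,2) s(1,3)] s(2,4) by simp
qed

lemma abs_continuous_lincomb:
  fixes x y :: "real \<Rightarrow> 'a::real_normed_vector"
  assumes x: "abs_continuous T x" and y: "abs_continuous T y"
  shows "abs_continuous T (\<lambda>t. c *\<^sub>R x t + d *\<^sub>R y t)"
  unfolding abs_continuous_def
proof (intro allI impI)
  fix \<epsilon> :: real assume \<epsilon>: "0 < \<epsilon>"
  \<comment> \<open>The summand 1 keeps \<open>k\<close> positive and makes the final estimate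
    strict.\<close>
  define k where "k = \<bar>c\<bar> + \<bar>d\<bar> + 1"
  have k: "0 < \<epsilon> / k" using \<epsilon> by (simp add: k_def)
  obtain d1 where d1: "0 < d1" "\<forall>(n::nat) a b.
        (\<forall>i<n. 0 \<le> a i \<and> a i \<le> b i \<and> b i \<le> T) \<and> disjoint_family_on (\<lambda>i. {a i<..<b i}) {..<n} \<and>
        (\<Sum>i<n. b i - a i) < d1 \<longrightarrow> (\<Sum>i<n. norm (x (b i) - x (a i))) < \<epsilon> / k"
    using x[unfolded abs_continuous_def, rule_format, OF k] by (elim exE conjE) (rule that)
  obtain d2 where d2: "0 < d2" "\<forall>(n::nat) a b.
        (\<forall>i<n. 0 \<le> a i \<and> a i \<le> b i \<and> b i \<le> T) \<and> disjoint_family_on (\<lambda>i. {a i<..<b i}) {..<n} \<and>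
        (\<Sum>i<n. b i - a i) < d2 \<longrightarrow> (\<Sum>i<n. norm (y (b i) - y (a i))) < \<epsilon> / k"
    using y[unfolded abs_continuous_def, rule_format, OF k] by (elim exE conjE) (rule that)
  show "\<exists>\<delta>>0. \<forall>(n::nat) a b.
        (\<forall>i<n. 0 \<le> a i \<and> a i \<le> b i \<and> b i \<le> T) \<and> disjoint_family_on (\<lambda>i. {a i<..<b i}) {..<n} \<and>
        (\<Sum>i<n. b i - a i) < \<delta> \<longrightarrow>
        (\<Sum>i<n. norm ((c *\<^sub>R x (b i) + d *\<^sub>R y (b i)) - (c *\<^sub>R x (a i) + d *\<^sub>R y (a i)))) < \<epsilon>"
  proof (intro exI[of _ "min d1 d2"] conjI allI impI)
    show "0 < min d1 d2" using d1 d2 by simp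
    fix n :: nat and a b
    assume *: "(\<forall>i<n. 0 \<le> a i \<and> a i \<le> b i \<and> b i \<le> T) \<and> disjoint_family_on (\<lambda>i. {a i<..<b i}) {..<n} \<and>
        (\<Sum>i<n. b i - a i) < min d1 d2"
    have 1: "(\<Sum>i<n. norm (x (b i) - x (a i))) < \<epsilon> / k" using d1(2) * by simp
    have 2: "(\<Sum>i<n. norm (y (b i) - y (a i))) < \<epsilon> / k" using d2(2) * by simp
    have "(\<Sum>i<n. norm ((c *\<^sub>R x (b i) + d *\<^sub>R y (b i)) - (c *\<^sub>R x (a i) + d *\<^sub>R y (a i)))) \<le>
        (\<Sum>i<n. \<bar>c\<bar> * norm (x (b i) - x (a i)) + \<bar>d\<bar> * norm (y (b i) - y (a i)))"
    proof (rule sum_mono)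
      fix i
      have "(c *\<^sub>R x (b i) + d *\<^sub>R y (b i)) - (c *\<^sub>R x (a i) + d *\<^sub>R y (a i)) =
          c *\<^sub>R (x (b i) - x (a i)) + d *\<^sub>R (y (b i) - y (a i))" by (simp add: algebra_simps)
      then show "norm ((c *\<^sub>R x (b i) + d *\<^sub>R y (b i)) - (c *\<^sub>R x (a i) + d *\<^sub>R y (a i))) \<le> 
          \<bar>c\<bar> * norm (x (b i) - x (a i)) + \<bar>d\<bar> * norm (y (b i) - y (a i))"
        using norm_triangle_ineq[of "c *\<^sub>R (x (b i) - x (a i))" "d *\<^sub>R (y (b i) - y (a i))"] by simp
    qed
    also have "\<dots> = \<bar>c\<bar> * (\<Sum>i<n. norm (x (b i) - x (a i))) + \<bar>d\<bar> * (\<Sum>i<n. norm (y (b i) - y (a i)))"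
      by (simp add: sum.distrib sum_distrib_left)
    also have "\<dots> \<le> \<bar>c\<bar> * (\<epsilon> / k) + \<bar>d\<bar> * (\<epsilon> / k)"
      using 1 2 by (intro add_mono mult_left_mono) auto
    also have "\<dots> = (k - 1) * (\<epsilon> / k)" by (simp only: k_def add_diff_cancel distrib_right)
    also have "\<dots> < k * (\<epsilon> / k)" using k by (intro mult_strict_right_mono) auto
    also have "\<dots> = \<epsilon>" using k \<epsilon> by auto
    finally show "(\<Sum>i<n. norm ((c *\<^sub>R x (b i) + d *\<^sub>R y (b i)) - (c *\<^sub>R x (a i) + d *\<^sub>R y (a i)))) < \<epsilon>" .
  qed
qed

text \<open>
  Elements of \<open>W1p\<close> together with their differentiability almost everywhere; for trajectories the
  latter is part of the differential equation, so that Lebesgue's differentiation theorem is not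
  needed.
\<close>

definition W1p_diff :: "ereal \<Rightarrow> real \<Rightarrow> (real \<Rightarrow> 'a::euclidean_space) set" where
  "W1p_diff p T = {x \<in> W1p p T. AE t in lebesgue_on {0..T}.
     (x has_vector_derivative deriv_on T x t) (at t within {0..T})}"

lemma AE_deriv_on_eq:
  assumes "0 < T" and "AE t in lebesgue_on {0..T}. (x has_vector_derivative g t) (at t within {0..T})"
  shows "AE t in lebesgue_on {0..T}. deriv_on T (x :: real \<Rightarrow> 'a::euclidean_space) t = g t"
proof -
  have "AE t in lebesgue_on {0..T}. t \<in> {0..T}" by (rule AE_I2) simp
  with assms(2) show ?thesis
    by eventually_elim (use assms(1) in \<open>simp add: deriv_on_def vector_derivative_within_closed_interval\<close>)
qed

text \<open>\<open>deriv_on\<close> takes its own values on the exceptional null set, so a known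
  derivative can replace it only almost everywhere; membership in \<open>Lp\<close> and the norm do
  not notice.\<close>

lemma W1p_diffI:
  assumes "0 < T" "abs_continuous T x" "g \<in> Lp p T"
    and der: "AE t in lebesgue_on {0..T}. (x has_vector_derivative g t) (at t within {0..T})"
  shows "x \<in> W1p_diff p T" "Lp_norm p T (deriv_on T x) = Lp_norm p T g"
proof -
  have ae: "AE t in lebesgue_on {0..T}. deriv_on T x t = g t" using assms(1) der by (rule AE_deriv_on_eq)
  then have ae': "AE t in lebesgue_on {0..T}. g t = deriv_on T x t" by eventually_elim simp
  from der ae have "AE t in lebesgue_on {0..T}. (x has_vector_derivative deriv_on T x t) (at t within {0..T})"
    by eventually_elim simp
  then show "x \<in> W1p_diff p T" 
    using assms Lp_AE_cong(1)[OF assms(3) ae'] by (simp add: W1p_diff_def W1p_def)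
  show "Lp_norm p T (deriv_on T x) = Lp_norm p T g" by (rule Lp_AE_cong(2)[OF assms(3) ae'])
qed

lemma W1p_diffD:
  assumes "x \<in> W1p_diff p T"
  shows "abs_continuous T x" "continuous_on {0..T} x" "deriv_on T x \<in> Lp p T"
    "AE t in lebesgue_on {0..T}. (x has_vector_derivative deriv_on T x t) (at t within {0..T})"
  using assms abs_continuous_imp_continuous_on by (auto simp: W1p_diff_def W1p_def)

lemma W1p_diff_lincomb:
  assumes p: "1 \<le> p" and T: "0 < T" and x: "x \<in> W1p_diff p T" and y: "y \<in> W1p_diff p T"
  shows "(\<lambda>t. c *\<^sub>R x t + d *\<^sub>R y t) \<in> W1p_diff p T"
    and "W1p_norm p T (\<lambda>t. c *\<^sub>R x t + d *\<^sub>R y t) \<le> \<bar>c\<bar> * W1p_norm p T x + \<bar>d\<bar> * W1p_norm p T y"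
proof -
  let ?g = "\<lambda>t. c *\<^sub>R deriv_on T x t + d *\<^sub>R deriv_on T y t"
  note g = Lp_lincomb[OF p T W1p_diffD(3)[OF x] W1p_diffD(3)[OF y], of c d]
  note xy = Lp_lincomb[OF p T continuous_on_imp_Lp[OF p T W1p_diffD(2)[OF x]] 
      continuous_on_imp_Lp[OF p T W1p_diffD(2)[OF y]], of c d]
  have der: "AE t in lebesgue_on {0..T}. ((\<lambda>t. c *\<^sub>R x t + d *\<^sub>R y t) has_vector_derivative ?g t) (at t within {0..T})"
    using W1p_diffD(4)[OF x] W1p_diffD(4)[OF y]
    by eventually_elim (auto intro!: derivative_eq_intros)
  note w = W1p_diffI[OF T abs_continuous_lincomb[OF W1p_diffD(1)[OF x] W1p_diffD(1)[OF y]] g(1) der]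
  show "(\<lambda>t. c *\<^sub>R x t + d *\<^sub>R y t) \<in> W1p_diff p T" by (rule w(1))
  show "W1p_norm p T (\<lambda>t. c *\<^sub>R x t + d *\<^sub>R y t) \<le> \<bar>c\<bar> * W1p_norm p T x + \<bar>d\<bar> * W1p_norm p T y"
    using g(2) xy(2) unfolding W1p_norm_def w(2) by (simp add: algebra_simps)
qed

lemma W1p_norm_nonneg:
  assumes "1 \<le> p" "0 < T" "x \<in> W1p_diff p T"
  shows "Lp_norm p T (deriv_on T x) \<le> W1p_norm p T x" "0 \<le> W1p_norm p T x"
  using Lp_norm_nonneg[OF assms(1,2) continuous_on_imp_Lp[OF assms(1,2) W1p_diffD(2)[OF assms(3)]]]
    Lp_norm_nonneg[OF assms(1,2) W1p_diffD(3)[OF assms(3)]] by (auto simp: W1p_norm_def)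

text \<open>The increment is the integral of the derivative, and \<open>1 + T\<close> is the
  constant of the embedding into integrable functions. The uniform bound on states and the Lipschitz
  constant of the endpoint error both come from here.\<close>

lemma W1p_diff_increment:
  assumes p: "1 \<le> p" and T: "0 < T" and x: "x \<in> W1p_diff p T" and b: "b \<in> {0..T}"
  shows "norm (x b - x 0) \<le> (1 + T) * W1p_norm p T x"
proof -
  let ?g = "deriv_on T x"
  note g = Lp_imp_integrable[OF p T W1p_diffD(3)[OF x]]
  have hi: "(?g has_integral (x b - x 0)) {0..b}"
    using b W1p_diffD(1,4)[OF x] by (intro abs_continuous_fundamental_theorem[of T]) auto
  have "integrable (lebesgue_on {0..T}) (\<lambda>t. norm (?g t))" using g(1) by simp
  then have n: "(\<lambda>t. norm (?g t)) integrable_on {0..T}" 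
    "(LINT t|lebesgue_on {0..T}. norm (?g t)) = integral {0..T} (\<lambda>t. norm (?g t))"
    by (auto intro: integrable_on_lebesgue_on lebesgue_integral_eq_integral)
  then have nb: "(\<lambda>t. norm (?g t)) integrable_on {0..b}"
    using b by (intro integrable_subinterval_real[OF n(1)]) auto
  have "norm (x b - x 0) = norm (integral {0..b} ?g)" using hi by (simp add: integral_unique)
  also have "\<dots> \<le> integral {0..b} (\<lambda>t. norm (?g t))"
    using hi nb by (intro Henstock_Kurzweil_Integration.integral_norm_bound_integral) auto
  also have "\<dots> \<le> integral {0..T} (\<lambda>t. norm (?g t))"
    using n(1) nb b by (intro integral_subset_le) auto
  also have "\<dots> \<le> (1 + T) * Lp_norm p T ?g" using g(2) n(2) by simp
  also have "\<dots> \<le> (1 + T) * W1p_norm p T x" using W1p_norm_nonneg[OF p T x] T by (intro mult_left_mono) auto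
  finally show ?thesis .
qed

text \<open>One operation gives differences (coefficients \<open>1\<close> and \<open>- 1\<close>)
  and points of segments (\<open>1 - a\<close> and \<open>a\<close>), so a single norm estimate
  serves distances and segments alike.\<close>

definition lincomb ::
  "real \<Rightarrow> ('d, 'm) process \<Rightarrow> real \<Rightarrow> ('d, 'm) process \<Rightarrow> ('d::finite, 'm::finite) process" where
  "lincomb a y b z = (\<lambda>t. a *\<^sub>R fst y t + b *\<^sub>R fst z t, \<lambda>t. a *\<^sub>R snd y t + b *\<^sub>R snd z t)"

lemma X_dist_eq: "X_dist p q T y z = X_norm p q T (lincomb 1 y (- 1) z)"
  by (simp add: X_dist_def lincomb_def)

lemma X_dist_lincomb:
  "X_dist p q T (lincomb (1 - a) y a z) y = X_norm p q T (lincomb a z (- a) y)"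
proof -
  have "lincomb 1 (lincomb (1 - a) y a z) (- 1) y = lincomb a z (- a) y"
    by (simp add: lincomb_def fun_eq_iff algebra_simps)
  then show ?thesis by (simp add: X_dist_eq)
qed

section \<open>Convexity and distance estimates for admissible processes\<close>

locale control_system =
  fixes p q :: ereal and T :: real
    and A :: "real \<Rightarrow> real ^ 'd::finite ^ 'd" and B :: "real \<Rightarrow> real ^ 'm::finite ^ 'd"
    and U :: "(real \<Rightarrow> real ^ 'm) set" and x0 :: "real ^ 'd"
  assumes p: "1 \<le> p" and q: "1 \<le> q" and T: "0 < T"
    and U: "U \<subseteq> Lp q T" "convex_funs U"
begin

abbreviation "K \<equiv> admissible p q T A B U x0"
abbreviation "V \<equiv> W1p_diff p T \<times> Lp q T :: ('d, 'm) process set"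
abbreviation "N \<equiv> X_norm p q T :: ('d, 'm) process \<Rightarrow> real"
abbreviation "D \<equiv> X_dist p q T :: ('d, 'm) process \<Rightarrow> ('d, 'm) process \<Rightarrow> real"

lemma V_lincomb: "y \<in> V \<Longrightarrow> z \<in> V \<Longrightarrow> lincomb a y b z \<in> V"
  using W1p_diff_lincomb(1)[OF p T] Lp_lincomb(1)[OF q T] by (auto simp: lincomb_def)

lemma N_lincomb: 
  assumes "y \<in> V" "z \<in> V"
  shows "N (lincomb a y b z) \<le> \<bar>a\<bar> * N y + \<bar>b\<bar> * N z"
proof -
  have "W1p_norm p T (fst (lincomb a y b z)) \<le> \<bar>a\<bar> * W1p_norm p T (fst y) + \<bar>b\<bar> * W1p_norm p T (fst z)"
    using W1p_diff_lincomb(2)[OF p T, of "fst y" "fst z" a b] assms by (auto simp: lincomb_def)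
  moreover have "Lp_norm q T (snd (lincomb a y b z)) \<le> \<bar>a\<bar> * Lp_norm q T (snd y) + \<bar>b\<bar> * Lp_norm q T (snd z)"
    using Lp_lincomb(2)[OF q T, of "snd y" "snd z" a b] assms by (auto simp: lincomb_def)
  ultimately show ?thesis by (simp add: X_norm_def algebra_simps)
qed

lemma N_bounds:
  assumes "z \<in> V"
  shows "W1p_norm p T (fst z) \<le> N z" "Lp_norm q T (snd z) \<le> N z" "0 \<le> N z"
  using W1p_norm_nonneg(2)[OF p T, of "fst z"] Lp_norm_nonneg[OF q T, of "snd z"] assms
  by (auto simp: X_norm_def)

lemma increment_le_N:
  assumes "z \<in> V" "t \<in> {0..T}"
  shows "norm (fst z t - fst z 0) \<le> (1 + T) * N z"
proof -
  have "norm (fst z t - fst z 0) \<le> (1 + T) * W1p_norm p T (fst z)"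
    using assms by (intro W1p_diff_increment[OF p T]) auto
  also have "\<dots> \<le> (1 + T) * N z" using N_bounds(1)[OF assms(1)] T by (intro mult_left_mono) auto
  finally show ?thesis .
qed

lemma admissibleD:
  assumes "z \<in> K"
  shows "z \<in> V" "fst z 0 = x0" "snd z \<in> U"
    "AE t in lebesgue_on {0..T}. (fst z has_vector_derivative (A t *v fst z t + B t *v snd z t)) (at t within {0..T})"
proof -
  show der: "AE t in lebesgue_on {0..T}. (fst z has_vector_derivative (A t *v fst z t + B t *v snd z t)) (at t within {0..T})"
    and "fst z 0 = x0" "snd z \<in> U" using assms by (auto simp: admissible_def)
  have z: "fst z \<in> W1p p T" "snd z \<in> Lp q T" using assms by (auto simp: admissible_def X_space_def)
  have "AE t in lebesgue_on {0..T}. (fst z has_vector_derivative deriv_on T (fst z) t) (at t within {0..T})"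
    using der AE_deriv_on_eq[OF T der] by eventually_elim simp
  with z show "z \<in> V" by (auto simp: W1p_diff_def mem_Times_iff)
qed

text \<open>The differential equation and the initial condition survive every affine combination;
  only the control constraint restricts \<open>a\<close>. It is kept as a premise to serve both
  convexity and, for unconstrained controls, affinity.\<close>

lemma K_lincomb:
  assumes y: "y \<in> K" and z: "z \<in> K" and u: "snd (lincomb (1 - a) y a z) \<in> U"
  shows "lincomb (1 - a) y a z \<in> K"
proof -
  let ?w = "lincomb (1 - a) y a z"
  have V: "?w \<in> V" using admissibleD(1)[OF y] admissibleD(1)[OF z] by (rule V_lincomb)
  then have X: "?w \<in> X_space p q T" by (auto simp: X_space_def W1p_diff_def)
  have "AE t in lebesgue_on {0..T}. (fst ?w has_vector_derivative (A t *v fst ?w t + B t *v snd ?w t)) (at t within {0..T})"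
    using admissibleD(4)[OF y] admissibleD(4)[OF z]
  proof eventually_elim
    case (elim t)
    have "(fst ?w has_vector_derivative ((1 - a) *\<^sub>R (A t *v fst y t + B t *v snd y t) +
        a *\<^sub>R (A t *v fst z t + B t *v snd z t))) (at t within {0..T})"
      unfolding lincomb_def fst_conv using elim by (auto intro!: derivative_eq_intros)
    moreover have "(1 - a) *\<^sub>R (A t *v fst y t + B t *v snd y t) + a *\<^sub>R (A t *v fst z t + B t *v snd z t) =
        A t *v fst ?w t + B t *v snd ?w t"
      unfolding lincomb_def fst_conv snd_conv
      by (simp add: matrix_vector_right_distrib matrix_vector_mult_scaleR scaleR_add_right)
    ultimately show ?case by simp
  qed
  moreover have "fst ?w 0 = x0"
    using admissibleD(2)[OF y] admissibleD(2)[OF z] by (simp add: lincomb_def flip: scaleR_add_left)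
  ultimately show ?thesis using X u by (auto simp: admissible_def case_prod_beta)
qed

lemma K_convex: "y \<in> K \<Longrightarrow> z \<in> K \<Longrightarrow> 0 \<le> a \<Longrightarrow> a \<le> 1 \<Longrightarrow> lincomb (1 - a) y a z \<in> K"
  using U(2) admissibleD(3) by (intro K_lincomb) (auto simp: convex_funs_def lincomb_def)

lemma D_refl: "y \<in> K \<Longrightarrow> D y y = 0"
proof -
  assume "y \<in> K"
  then have y: "y \<in> V" by (rule admissibleD)
  have "lincomb 1 y (- 1) y = lincomb 0 y 0 y" by (simp add: lincomb_def)
  then show ?thesis
    using N_lincomb[OF y y, of 0 0] N_bounds(3)[OF V_lincomb[OF y y, of 0 0]] by (simp add: X_dist_eq)
qed

lemma D_triangle:
  assumes "x \<in> K" "y \<in> K" "z \<in> K"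
  shows "D x z \<le> D x y + D y z"
proof -
  have "lincomb 1 x (- 1) z = lincomb 1 (lincomb 1 x (- 1) y) 1 (lincomb 1 y (- 1) z)"
    by (simp add: lincomb_def)
  then have "N (lincomb 1 x (- 1) z) = N (lincomb 1 (lincomb 1 x (- 1) y) 1 (lincomb 1 y (- 1) z))"
    by (rule arg_cong)
  also have "\<dots> \<le> \<bar>1\<bar> * N (lincomb 1 x (- 1) y) + \<bar>1\<bar> * N (lincomb 1 y (- 1) z)"
    using assms by (intro N_lincomb V_lincomb admissibleD)
  finally show ?thesis by (simp add: X_dist_eq)
qed

lemma N_le_D:
  assumes "y \<in> K" "z \<in> K"
  shows "N y \<le> N z + D y z"
proof -
  have "y = lincomb 1 z 1 (lincomb 1 y (- 1) z)" by (simp add: lincomb_def)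
  then have "N y = N (lincomb 1 z 1 (lincomb 1 y (- 1) z))" by (rule arg_cong)
  also have "\<dots> \<le> \<bar>1\<bar> * N z + \<bar>1\<bar> * N (lincomb 1 y (- 1) z)"
    using assms by (intro N_lincomb V_lincomb admissibleD)
  finally show ?thesis by (simp add: X_dist_eq)
qed

text \<open>Admissible trajectories share the initial state, so their difference equals its own
  increment from time 0.\<close>

lemma diff_le_D:
  assumes "y \<in> K" "z \<in> K" "t \<in> {0..T}"
  shows "norm (fst y t - fst z t) \<le> (1 + T) * D y z"
  using increment_le_N[OF V_lincomb[OF admissibleD(1)[OF assms(1)] admissibleD(1)[OF assms(2)]] assms(3), of 1 "- 1"]
    admissibleD(2)[OF assms(1)] admissibleD(2)[OF assms(2)] by (simp add: X_dist_eq) (simp add: lincomb_def)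

lemma state_bound:
  assumes "z \<in> K" "t \<in> {0..T}"
  shows "norm (fst z t) \<le> norm x0 + (1 + T) * N z"
  using increment_le_N[OF admissibleD(1)[OF assms(1)] assms(2)] admissibleD(2)[OF assms(1)]
    norm_triangle_sub[of "fst z t" x0] by simp

lemma reachable_set_eq: "reachable_set T K = (\<lambda>z. fst z T) ` K"
  by (force simp: reachable_set_def)

text \<open>An affine set is its own relative interior. This is why the interiority assumption is
  automatic for unconstrained controls.\<close>

lemma affine_reachable_set:
  assumes "U = Lp q T"
  shows "affine (reachable_set T K)"
  unfolding affine_alt reachable_set_eq
proof (intro ballI allI)
  fix a b and c :: real assume "a \<in> (\<lambda>z. fst z T) ` K" "b \<in> (\<lambda>z. fst z T) ` K"
  then obtain y z where yz: "y \<in> K" "z \<in> K" "a = fst y T" "b = fst z T" by auto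
  have "lincomb (1 - c) y c z \<in> K"
    using yz assms V_lincomb[OF admissibleD(1) admissibleD(1), of y z "1 - c" c] by (intro K_lincomb) (auto simp: mem_Times_iff)
  then show "(1 - c) *\<^sub>R a + c *\<^sub>R b \<in> (\<lambda>z. fst z T) ` K"
    using yz by (intro image_eqI[of _ _ "lincomb (1 - c) y c z"]) (auto simp: lincomb_def)
qed

text \<open>
  This bounded controllability replaces an open mapping theorem: the endpoints of trajectories of
  norm at most \<open>n\<close> form an increasing sequence of convex sets exhausting the reachable set.
\<close>

lemma bounded_preimages:
  assumes "xT \<in> rel_interior (reachable_set T K)"
  shows "\<exists>n r. 0 < r \<and> (\<forall>w \<in> cball xT r \<inter> affine hull (reachable_set T K). \<exists>z\<in>K. N z \<le> n \<and> fst z T = w)"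
proof -
  define E where "E n = (\<lambda>z. fst z T) ` {z \<in> K. N z \<le> real n}" for n
  have R: "reachable_set T K = (\<Union>n. E n)"
    using real_arch_simple by (fastforce simp: reachable_set_eq E_def)
  have convex: "convex (E n)" for n
    unfolding convex_alt
  proof (intro ballI allI impI)
    fix a b and c :: real assume "a \<in> E n" "b \<in> E n" and c: "0 \<le> c \<and> c \<le> 1"
    then obtain y z where yz: "y \<in> K" "z \<in> K" "N y \<le> n" "N z \<le> n" "a = fst y T" "b = fst z T" 
      by (auto simp: E_def)
    have "N (lincomb (1 - c) y c z) \<le> \<bar>1 - c\<bar> * N y + \<bar>c\<bar> * N z"
      using yz by (intro N_lincomb admissibleD)
    also have "\<dots> \<le> (1 - c) * n + c * n" using c yz by (auto intro!: add_mono mult_left_mono)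
    also have "\<dots> = n" by (simp add: algebra_simps)
    finally show "(1 - c) *\<^sub>R a + c *\<^sub>R b \<in> E n"
      using yz c K_convex[OF yz(1,2), of c] unfolding E_def 
      by (intro image_eqI[of _ _ "lincomb (1 - c) y c z"]) (auto simp: lincomb_def)
  qed
  have mono: "E m \<subseteq> E n" if "m \<le> n" for m n
    using that unfolding E_def by (intro image_mono) auto
  obtain n where n: "xT \<in> rel_interior (E n)" "affine hull E n = affine hull (\<Union>n. E n)"
    using rel_interior_increasing_union[of E xT, OF convex mono] assms R by auto
  then obtain r where "0 < r" "cball xT r \<inter> affine hull (reachable_set T K) \<subseteq> E n"
    unfolding mem_rel_interior_cball R by auto
  then show ?thesis by (intro exI[of _ "real n"] exI[of _ r]) (auto simp: E_def)
qed

end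

section \<open>Cost and endpoint error on the admissible set\<close>

locale control_problem = control_system p q T A B U x0 + integrand q T \<theta> \<theta>\<^sub>x \<theta>\<^sub>u
  for p q T and A :: "real \<Rightarrow> real ^ 'd::finite ^ 'd" and B :: "real \<Rightarrow> real ^ 'm::finite ^ 'd"
    and U x0 and \<theta> :: "real ^ 'd \<Rightarrow> real ^ 'm \<Rightarrow> real \<Rightarrow> real" and \<theta>\<^sub>x \<theta>\<^sub>u
begin

abbreviation "I \<equiv> cost T \<theta>"

text \<open>At distance zero the states agree at every time and the controls almost everywhere, so
  the integrands agree almost everywhere.\<close>

lemma cost_cong:
  assumes "y \<in> K" "z \<in> K" "D y z = 0"
  shows "I y = I z"
proof -
  have V: "lincomb 1 y (- 1) z \<in> V" using assms by (intro V_lincomb admissibleD)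
  have "Lp_norm q T (snd (lincomb 1 y (- 1) z)) = 0"
    using N_bounds(2)[OF V] assms(3) Lp_norm_nonneg[OF q T, of "snd (lincomb 1 y (- 1) z)"] V
    by (auto simp: X_dist_eq mem_Times_iff)
  then have "AE t in M\<^sub>T. snd (lincomb 1 y (- 1) z) t = 0"
    using V by (intro Lp_norm_eq_0_imp_AE[OF q T]) (auto simp: mem_Times_iff)
  then have "AE t in M\<^sub>T. \<theta> (fst y t) (snd y t) t = \<theta> (fst z t) (snd z t) t"
    using AE_interval
  proof eventually_elim
    case (elim t)
    then show ?case using diff_le_D[OF assms(1,2), of t] assms(3) by (simp add: lincomb_def)
  qed
  moreover have "(\<lambda>t. \<theta> (fst w t) (snd w t) t) \<in> borel_measurable M\<^sub>T" if "w \<in> K" for w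
    using admissibleD(1)[OF that] W1p_diffD(2)
    by (intro measurable_along continuous_imp_measurable_on_sets_lebesgue Lp_measurable[of _ q]) auto
  ultimately show ?thesis
    unfolding cost_def using assms by (intro integral_cong_AE) auto
qed

lemma cost_lipschitz_segment:
  "\<exists>L\<ge>0. \<forall>y\<in>K. \<forall>z\<in>K. N y \<le> M \<longrightarrow> N z \<le> M \<longrightarrow> (\<forall>a\<in>{0..1}. I (lincomb (1 - a) y a z) \<le> I y + a * L)"
proof -
  \<comment> \<open>The state bound for processes of norm at most \<open>M\<close>, enlarged so that
    it is positive for every real \<open>M\<close>.\<close>
  define R where "R = norm x0 + (1 + T) * (\<bar>M\<bar> + 1)"
  have R: "0 < R" using T unfolding R_def by (intro add_nonneg_pos mult_pos_pos) auto
  have M: "0 < \<bar>M\<bar> + 1" by simp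
  obtain L where L: "0 \<le> L" "\<forall>x y u v a. continuous_on {0..T} x \<longrightarrow> continuous_on {0..T} y \<longrightarrow> 
    (\<forall>t\<in>{0..T}. norm (x t) \<le> R \<and> norm (y t) \<le> R) \<longrightarrow> u \<in> Lp q T \<longrightarrow> v \<in> Lp q T \<longrightarrow>
    Lp_norm q T u \<le> \<bar>M\<bar> + 1 \<longrightarrow> Lp_norm q T v \<le> \<bar>M\<bar> + 1 \<longrightarrow> 0 \<le> a \<longrightarrow> a \<le> 1 \<longrightarrow>
    \<bar>(LINT t|M\<^sub>T. \<theta> ((1 - a) *\<^sub>R x t + a *\<^sub>R y t) ((1 - a) *\<^sub>R u t + a *\<^sub>R v t) t) - (LINT t|M\<^sub>T. \<theta> (x t) (u t) t)\<bar> \<le> a * L"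
    using integral_lipschitz_segment[OF R M] by (elim exE conjE) (rule that)
  show ?thesis
  proof (intro exI[of _ L] conjI L(1) ballI impI)
    fix y z :: "('d, 'm) process" and a :: real 
    assume yz: "y \<in> K" "z \<in> K" "N y \<le> M" "N z \<le> M" "a \<in> {0..1}"
    have bd: "continuous_on {0..T} (fst w) \<and> (\<forall>t\<in>{0..T}. norm (fst w t) \<le> R) \<and> snd w \<in> Lp q T \<and> Lp_norm q T (snd w) \<le> \<bar>M\<bar> + 1"
      if w: "w \<in> K" "N w \<le> M" for w
    proof (intro conjI ballI)
      show "continuous_on {0..T} (fst w)" "snd w \<in> Lp q T" 
        using admissibleD(1)[OF w(1)] W1p_diffD(2) by (auto simp: mem_Times_iff)
      show "Lp_norm q T (snd w) \<le> \<bar>M\<bar> + 1" using N_bounds(2)[OF admissibleD(1)[OF w(1)]] w(2) by linarith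
      fix t assume "t \<in> {0..T}"
      then have "norm (fst w t) \<le> norm x0 + (1 + T) * N w" by (rule state_bound[OF w(1)])
      also have "\<dots> \<le> R" unfolding R_def using w(2) T by (intro add_left_mono mult_left_mono) auto
      finally show "norm (fst w t) \<le> R" .
    qed
    have "\<bar>I (lincomb (1 - a) y a z) - I y\<bar> \<le> a * L"
      using L(2)[rule_format, of "fst y" "fst z" "snd y" "snd z" a] bd[OF yz(1,3)] bd[OF yz(2,4)] yz(5)
      by (simp add: cost_def lincomb_def)
    then show "I (lincomb (1 - a) y a z) \<le> I y + a * L" by linarith
  qed
qed

lemma descent_towards_endpoint:
  assumes ri: "xT \<in> rel_interior (reachable_set T K)"
  shows "\<exists>\<kappa>>0. \<exists>L\<ge>0. \<exists>r>0. \<forall>y\<in>K. N y \<le> M \<longrightarrow> 0 < endpoint_error T xT y \<longrightarrow> (\<exists>g. \<forall>a. 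
         0 < a \<and> a \<le> endpoint_error T xT y / (endpoint_error T xT y + r) \<longrightarrow>
         g a \<in> K \<and> I (g a) \<le> I y + a * L \<and> D (g a) y \<le> a * \<kappa> \<and>
         endpoint_error T xT (g a) = endpoint_error T xT y - a * (endpoint_error T xT y + r))"
proof -
  obtain n r where r: "0 < r"
    and pre: "\<And>w. w \<in> cball xT r \<Longrightarrow> w \<in> affine hull (reachable_set T K) \<Longrightarrow> \<exists>z\<in>K. N z \<le> n \<and> fst z T = w"
    using bounded_preimages[OF ri] by blast
  \<comment> \<open>A common norm bound for the process to be improved and for the targets, so that
    one \<open>L\<close> serves all segments.\<close>
  let ?M = "max M n"
  obtain L where L: "0 \<le> L" 
    "\<And>y z a. y \<in> K \<Longrightarrow> z \<in> K \<Longrightarrow> N y \<le> ?M \<Longrightarrow> N z \<le> ?M \<Longrightarrow> a \<in> {0..1} \<Longrightarrow> I (lincomb (1 - a) y a z) \<le> I y + a * L"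
    using cost_lipschitz_segment[of ?M] by metis
  \<comment> \<open>Moving by the fraction \<open>a\<close> towards \<open>v\<close> displaces
    \<open>y\<close> by \<open>a\<close> times the difference of the two processes, whose norm is at
    most \<open>n + M\<close>.\<close>
  define \<kappa> where "\<kappa> = \<bar>n\<bar> + \<bar>M\<bar> + 1"
  have \<kappa>: "0 < \<kappa>" by (simp add: \<kappa>_def)
  let ?\<phi> = "endpoint_error T xT"
  show ?thesis
  proof (rule exI[of _ \<kappa>], intro conjI \<kappa>, rule exI[of _ L], intro conjI L(1), rule exI[of _ r], intro conjI r ballI impI)
    fix y assume y: "y \<in> K" "N y \<le> M" "0 < ?\<phi> y"
    \<comment> \<open>This scaling places the target \<open>w\<close> at distance exactly
      \<open>r\<close> from \<open>xT\<close>, on the side opposite to the endpoint of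
      \<open>y\<close>.\<close>
    define s where "s = r / ?\<phi> y"
    \<comment> \<open>Written with coefficients of sum 1, since that shows membership in the affine
      hull; the next line gives the metric form.\<close>
    define w where "w = (1 + s) *\<^sub>R xT + (- s) *\<^sub>R fst y T"
    have w: "w = xT - s *\<^sub>R (fst y T - xT)" by (simp add: w_def algebra_simps)
    have s: "s * ?\<phi> y = r" "0 < s" using y(3) r by (auto simp: s_def)
    have "norm (s *\<^sub>R (fst y T - xT)) = r" using s by (simp add: endpoint_error_def)
    then have "w \<in> cball xT r" by (simp add: w dist_norm)
    moreover have "w \<in> affine hull (reachable_set T K)"
      unfolding w_def
    proof (rule mem_affine[OF affine_affine_hull])
      show "xT \<in> affine hull (reachable_set T K)"
        using subsetD[OF rel_interior_subset ri] by (rule hull_inc)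
      show "fst y T \<in> affine hull (reachable_set T K)"
        using y(1) by (intro hull_inc) (simp add: reachable_set_eq)
    qed simp
    ultimately obtain v where v: "v \<in> K" "N v \<le> n" "fst v T = w" using pre by blast
    show "\<exists>g. \<forall>a. 0 < a \<and> a \<le> ?\<phi> y / (?\<phi> y + r) \<longrightarrow>
         g a \<in> K \<and> I (g a) \<le> I y + a * L \<and> D (g a) y \<le> a * \<kappa> \<and> ?\<phi> (g a) = ?\<phi> y - a * (?\<phi> y + r)"
    proof (intro exI[of _ "\<lambda>a. lincomb (1 - a) y a v"] allI impI)
      fix a assume a: "0 < a \<and> a \<le> ?\<phi> y / (?\<phi> y + r)"
      let ?g = "lincomb (1 - a) y a v"
      have a': "a * (?\<phi> y + r) \<le> ?\<phi> y" using a y(3) r by (simp add: pos_le_divide_eq)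
      have "?\<phi> y / (?\<phi> y + r) \<le> 1" using y(3) r by simp
      then have a01: "0 \<le> a" "a \<le> 1" using a by linarith+
      have "D ?g y \<le> a * N v + a * N y"
        using N_lincomb[OF admissibleD(1)[OF v(1)] admissibleD(1)[OF y(1)], of a "- a"] a01 by (simp add: X_dist_lincomb)
      also have "\<dots> = a * (N v + N y)" by (simp add: distrib_left)
      also have "\<dots> \<le> a * \<kappa>" using a01 v(2) y(2) by (intro mult_left_mono) (auto simp: \<kappa>_def)
      finally have D: "D ?g y \<le> a * \<kappa>" .
      \<comment> \<open>The error vector is only rescaled. As \<open>s\<close> times the error of
        \<open>y\<close> is \<open>r\<close>, its length becomes the absolute value of
        \<open>?\<phi> y - a * (?\<phi> y + r)\<close>, and the bound on \<open>a\<close> makes this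
        nonnegative.\<close>
      have "fst ?g T - xT = (1 - a * (1 + s)) *\<^sub>R (fst y T - xT)"
        unfolding lincomb_def fst_conv v(3) w by (simp add: algebra_simps)
      then have "?\<phi> ?g = \<bar>1 - a * (1 + s)\<bar> * ?\<phi> y" by (simp add: endpoint_error_def)
      also have "\<dots> = \<bar>(1 - a * (1 + s)) * ?\<phi> y\<bar>" using y(3) by (simp add: abs_mult)
      also have "(1 - a * (1 + s)) * ?\<phi> y = ?\<phi> y - a * (?\<phi> y + r)"
        unfolding s(1)[symmetric] by (simp add: algebra_simps)
      also have "\<bar>\<dots>\<bar> = ?\<phi> y - a * (?\<phi> y + r)" using a' by simp
      finally have "?\<phi> ?g = ?\<phi> y - a * (?\<phi> y + r)" .
      moreover have "?g \<in> K" using K_convex[OF y(1) v(1) a01] .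
      moreover have "I ?g \<le> I y + a * L" using y v a01 by (intro L(2)) auto
      ultimately show "?g \<in> K \<and> I ?g \<le> I y + a * L \<and> D ?g y \<le> a * \<kappa> \<and> ?\<phi> ?g = ?\<phi> y - a * (?\<phi> y + r)"
        using D by blast
    qed
  qed
qed

lemma endpoint_error_lipschitz:
  assumes "y \<in> K" "z \<in> K"
  shows "\<bar>endpoint_error T xT y - endpoint_error T xT z\<bar> \<le> (1 + T) * D y z"
  using norm_triangle_ineq3[of "fst y T - xT" "fst z T - xT"] diff_le_D[OF assms, of T] T
  by (simp add: endpoint_error_def)

end

theorem theorem6:
  fixes p q :: ereal and T :: real and x0 xT :: "real ^ 'd::finite"
    and U :: "(real \<Rightarrow> real ^ 'm::finite) set"
    and A :: "real \<Rightarrow> real ^ 'd ^ 'd" and B :: "real \<Rightarrow> real ^ 'm ^ 'd"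
    and \<theta> :: "real ^ 'd \<Rightarrow> real ^ 'm \<Rightarrow> real \<Rightarrow> real"
    and \<theta>\<^sub>x :: "real ^ 'd \<Rightarrow> real ^ 'm \<Rightarrow> real \<Rightarrow> real ^ 'd"
    and \<theta>\<^sub>u :: "real ^ 'd \<Rightarrow> real ^ 'm \<Rightarrow> real \<Rightarrow> real ^ 'm"
    and \<mu>\<^sub>0 c \<delta> :: real
  defines "K \<equiv> admissible p q T A B U x0"
    and "\<phi> \<equiv> endpoint_error T xT"
    and "I \<equiv> cost T \<theta>"
  assumes "1 \<le> p" and "p \<le> q" and "0 < T"
    and U: "closed_in_Lp q T U" "convex_funs U"
    and AB: "A \<in> Lp \<infinity> T" "B \<in> Lp \<infinity> T"
    and cont: "continuous_on (UNIV \<times> UNIV \<times> {0..T}) (\<lambda>(x, u, t). \<theta> x u t)"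
    and grad_x: "\<And>x u t. t \<in> {0..T} \<Longrightarrow> GDERIV (\<lambda>y. \<theta> y u t) x :> \<theta>\<^sub>x x u t"
    and grad_u: "\<And>x u t. t \<in> {0..T} \<Longrightarrow> GDERIV (\<lambda>v. \<theta> x v t) u :> \<theta>\<^sub>u x u t"
    and cont_x: "continuous_on (UNIV \<times> UNIV \<times> {0..T}) (\<lambda>(x, u, t). \<theta>\<^sub>x x u t)"
    and cont_u: "continuous_on (UNIV \<times> UNIV \<times> {0..T}) (\<lambda>(x, u, t). \<theta>\<^sub>u x u t)"
    and growth: "q = \<infinity> \<or>
      growth_condition T (real_of_ereal q) 1 \<theta> \<and>
      growth_condition T (real_of_ereal q) 1 \<theta>\<^sub>x \<and>
      growth_condition T (real_of_ereal q - 1) (conj_exponent q) \<theta>\<^sub>u"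
    and opt: "\<exists>z. globally_optimal I (feasible_set K \<phi>) z"
    and ri: "U \<noteq> Lp q T \<Longrightarrow> xT \<in> rel_interior (reachable_set T K)"
    and "0 < \<mu>\<^sub>0" and "optimal_value I (feasible_set K \<phi>) < ereal c" and "0 < \<delta>"
    and bounded: "\<exists>M. \<forall>z \<in> sublevel K (penalty I \<phi> \<mu>\<^sub>0) c \<inter> sublevel K \<phi> \<delta>. X_norm p q T z \<le> M"
    and below: "bdd_below (penalty I \<phi> \<mu>\<^sub>0 ` K)"
  shows "(U = Lp q T \<longrightarrow> xT \<in> rel_interior (reachable_set T K)) \<and>
    (\<exists>\<mu>\<^sub>1\<ge>0. \<forall>\<mu>\<ge>\<mu>\<^sub>1. completely_exact (X_dist p q T) K I \<phi> \<mu> (sublevel K (penalty I \<phi> \<mu>) c))"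
proof -
  have q: "1 \<le> q" using \<open>1 \<le> p\<close> \<open>p \<le> q\<close> by (rule order_trans)
  interpret cp: control_problem p q T A B U x0 \<theta> \<theta>\<^sub>x \<theta>\<^sub>u
  proof (unfold_locales)
    show "U \<subseteq> Lp q T" using U(1) by (simp add: closed_in_Lp_def)
  qed fact+
  obtain z0 where z0: "globally_optimal I (feasible_set K \<phi>) z0" using opt by blast
  then have z0K: "z0 \<in> K" "fst z0 T = xT" 
    by (auto simp: globally_optimal_def feasible_set_def \<phi>_def endpoint_error_def)
  \<comment> \<open>The endpoint \<open>xT\<close> is reachable because an optimal, hence feasible,
    process ends there.\<close>
  have aff: "xT \<in> rel_interior (reachable_set T K)" if "U = Lp q T"
  proof -
    have "xT \<in> reachable_set T K" using z0K cp.reachable_set_eq by (auto simp: K_def)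
    then show ?thesis using rel_interior_affine[OF cp.affine_reachable_set[OF that]] by (simp add: K_def)
  qed
  then have ri': "xT \<in> rel_interior (reachable_set T K)" using ri by blast
  have "ereal (I z0) \<le> optimal_value I (feasible_set K \<phi>)"
    using z0 unfolding optimal_value_def globally_optimal_def by (intro INF_greatest) auto
  then have c: "I z0 < c" using \<open>optimal_value I (feasible_set K \<phi>) < ereal c\<close> by (metis ereal_less_eq(3) less_ereal.simps(1) le_less_trans)
  obtain M where M: "\<forall>z \<in> sublevel K (penalty I \<phi> \<mu>\<^sub>0) c \<inter> sublevel K \<phi> \<delta>. X_norm p q T z \<le> M"
    using bounded by blast
  obtain m where m: "\<And>z. z \<in> K \<Longrightarrow> m \<le> penalty I \<phi> \<mu>\<^sub>0 z"
    using below unfolding bdd_below_def by auto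
  have "\<exists>\<mu>\<^sub>1\<ge>0. \<forall>\<mu>\<ge>\<mu>\<^sub>1. completely_exact (X_dist p q T) K I \<phi> \<mu> (sublevel K (penalty I \<phi> \<mu>) c)"
  proof (rule completely_exact_if_descent[where N = "X_norm p q T" and C = "1 + T" and \<delta> = \<delta> and M = M 
        and m = m and \<mu>\<^sub>0 = \<mu>\<^sub>0, OF _ _ _ _ _ _ _ _ z0 c \<open>0 < \<delta>\<close> _ m])
    show "\<And>z. z \<in> K \<Longrightarrow> penalty I \<phi> \<mu>\<^sub>0 z < c \<Longrightarrow> \<phi> z < \<delta> \<Longrightarrow> X_norm p q T z \<le> M"
      using M by (auto simp: sublevel_def)
    show "\<And>y. 0 \<le> \<phi> y" by (simp add: \<phi>_def endpoint_error_def)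
    show "0 < 1 + T" using \<open>0 < T\<close> by simp
  qed (unfold K_def I_def \<phi>_def, 
      (fact cp.D_refl cp.D_triangle cp.N_le_D cp.endpoint_error_lipschitz cp.cost_cong
       cp.descent_towards_endpoint[OF ri'[unfolded K_def]] | assumption)+)
  then show ?thesis using aff by blast
qed

end
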